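(* Let $H$ be an infinite-dimensional Hilbert space and let $D$ be a masa in $\mathcal{B}(H)$. Then there is a bounded right $D$-module map $T\colon\mathcal{K}(H)\to\mathcal{K}(H)$ which is not completely bounded.
   Context: Hilbert spaces are complex and not assumed separable. $\mathcal{B}(H)$ is the algebra of bounded linear operators on $H$ and $\mathcal{K}(H)$ the ideal of compact operators. A masa is a maximal abelian self-adjoint subalgebra. A right $D$-module map on $\mathcal{K}(H)$ is a linear map $T\colon\mathcal{K}(H)\to\mathcal{K}(H)$ with $T(xd)=T(x)d$ for all $x\in\mathcal{K}(H)$, $d\in D$. $T$ is bounded if $\|T\|=\sup\{\|Tx\|\colon x\in\mathcal{K}(H),\ \|x\|\le1\}<\infty$. The space $M_n(\mathcal{K}(H))$ of $n\times n$ matrices over $\mathcal{K}(H)$ carries the operator norm from $\mathcal{B}(H^n)$, $T_n[x_{ij}]=[Tx_{ij}]$ on $M_n(\mathcal{K}(H))$, and $T$ is completely bounded if $\|T\|_{cb}=\sup_{n\ge1}\|T_n\|<\infty$. *)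

theory Defs
  imports "HOL-Analysis.Analysis"
begin

text \<open>
  Complex Hilbert spaces, not assumed separable. The inner product is linear in the first
  argument. The real vector space structure, the norm and the topology come from class
  \<^class>\<open>banach\<close>; the axioms below tie them to the complex structure.
\<close>

class complex_vector = real_vector +
  fixes scaleC :: "complex \<Rightarrow> 'a \<Rightarrow> 'a"  (infixr "*\<^sub>C" 75)
  assumes scaleC_add_right: "a *\<^sub>C (x + y) = a *\<^sub>C x + a *\<^sub>C y"
    and scaleC_add_left: "(a + b) *\<^sub>C x = a *\<^sub>C x + b *\<^sub>C x"
    and scaleC_scaleC: "a *\<^sub>C (b *\<^sub>C x) = (a * b) *\<^sub>C x"
    and scaleR_scaleC: "r *\<^sub>R x = complex_of_real r *\<^sub>C x"

class complex_hilbert_space = complex_vector + banach +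
  fixes cinner :: "'a \<Rightarrow> 'a \<Rightarrow> complex"
  assumes cinner_commute: "cinner x y = cnj (cinner y x)"
    and cinner_add_left: "cinner (x + y) z = cinner x z + cinner y z"
    and cinner_scaleC_left: "cinner (a *\<^sub>C x) y = a * cinner x y"
    and cinner_self_nonneg: "0 \<le> Re (cinner x x)"
    and cinner_self_eq_0: "cinner x x = 0 \<longleftrightarrow> x = 0"
    and norm_eq_sqrt_cinner: "norm x = sqrt (Re (cinner x x))"

lemma scaleC_one: "1 *\<^sub>C (x :: 'a::complex_vector) = x"
  using scaleR_scaleC[of 1 x] by simp

global_interpretation complex_vector:
  vector_space "scaleC :: complex \<Rightarrow> 'a \<Rightarrow> 'a::complex_vector"
  defines cspan = complex_vector.span
  by unfold_locales (simp_all add: scaleC_add_right scaleC_add_left scaleC_scaleC scaleC_one)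

lemma norm_scaleC: "norm (a *\<^sub>C (x :: 'a::complex_hilbert_space)) = cmod a * norm x"
proof -
  have "cinner (a *\<^sub>C x) (a *\<^sub>C x) = a * cnj a * cinner x x"
    by (metis cinner_commute cinner_scaleC_left complex_cnj_mult mult.assoc)
  also have "a * cnj a = complex_of_real ((cmod a)\<^sup>2)"
    by (rule complex_norm_square[symmetric])
  finally show ?thesis
    by (simp add: norm_eq_sqrt_cinner real_sqrt_mult)
qed

lemma bounded_linear_scaleC:
  "bounded_linear (\<lambda>x :: 'a::complex_hilbert_space. a *\<^sub>C x)"
proof (rule bounded_linear_intro[where K = "cmod a"])
  show "a *\<^sub>C (r *\<^sub>R x) = r *\<^sub>R (a *\<^sub>C x)" for r and x :: 'a
    by (simp add: scaleR_scaleC scaleC_scaleC mult.commute)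
qed (simp_all add: scaleC_add_right norm_scaleC mult.commute)

text \<open>
  The type \<open>'a \<Rightarrow>\<^sub>L 'a\<close> consists of the bounded \<^emph>\<open>real\<close>-linear maps, with the operator norm;
  \<open>\<B>(H)\<close> is the subset of complex-linear ones.
\<close>

definition bounded_ops :: "('a::complex_hilbert_space \<Rightarrow>\<^sub>L 'a) set" where
  "bounded_ops = {A. \<forall>c x. blinfun_apply A (c *\<^sub>C x) = c *\<^sub>C blinfun_apply A x}"

definition compact_ops :: "('a::complex_hilbert_space \<Rightarrow>\<^sub>L 'a) set" where
  "compact_ops = {A \<in> bounded_ops. compact (closure (blinfun_apply A ` cball 0 1))}"

definition op_scaleC ::
    "complex \<Rightarrow> ('a::complex_hilbert_space \<Rightarrow>\<^sub>L 'a) \<Rightarrow> ('a \<Rightarrow>\<^sub>L 'a)" where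
  "op_scaleC c A = Blinfun (\<lambda>x. c *\<^sub>C blinfun_apply A x)"

lemma op_scaleC_apply: "blinfun_apply (op_scaleC c A) x = c *\<^sub>C blinfun_apply A x"
  unfolding op_scaleC_def
  by (subst bounded_linear_Blinfun_apply)
     (simp_all add: bounded_linear_compose[OF bounded_linear_scaleC blinfun.bounded_linear_right])

definition is_adjoint ::
    "('a::complex_hilbert_space \<Rightarrow>\<^sub>L 'a) \<Rightarrow> ('a \<Rightarrow>\<^sub>L 'a) \<Rightarrow> bool" where
  "is_adjoint A B \<longleftrightarrow>
     (\<forall>x y. cinner (blinfun_apply A x) y = cinner x (blinfun_apply B y))"

definition abelian_selfadjoint_subalgebra ::
    "('a::complex_hilbert_space \<Rightarrow>\<^sub>L 'a) set \<Rightarrow> bool" where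
  "abelian_selfadjoint_subalgebra D \<longleftrightarrow>
     D \<subseteq> bounded_ops \<and> 0 \<in> D \<and>
     (\<forall>A\<in>D. \<forall>B\<in>D. A + B \<in> D) \<and>
     (\<forall>c. \<forall>A\<in>D. op_scaleC c A \<in> D) \<and>
     (\<forall>A\<in>D. \<forall>B\<in>D. A o\<^sub>L B \<in> D) \<and>
     (\<forall>A\<in>D. \<exists>B\<in>D. is_adjoint A B) \<and>
     (\<forall>A\<in>D. \<forall>B\<in>D. A o\<^sub>L B = B o\<^sub>L A)"

definition masa :: "('a::complex_hilbert_space \<Rightarrow>\<^sub>L 'a) set \<Rightarrow> bool" where
  "masa D \<longleftrightarrow> abelian_selfadjoint_subalgebra D \<and>
     (\<forall>E. abelian_selfadjoint_subalgebra E \<and> D \<subseteq> E \<longrightarrow> E = D)"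

text \<open>
  Maps on \<open>\<K>(H)\<close> are total functions on the operator type of which only the values on
  \<^const>\<open>compact_ops\<close> are ever used.
\<close>

definition right_module_map ::
    "('a::complex_hilbert_space \<Rightarrow>\<^sub>L 'a) set \<Rightarrow> (('a \<Rightarrow>\<^sub>L 'a) \<Rightarrow> ('a \<Rightarrow>\<^sub>L 'a)) \<Rightarrow> bool" where
  "right_module_map D T \<longleftrightarrow>
     T \<in> compact_ops \<rightarrow> compact_ops \<and>
     (\<forall>x\<in>compact_ops. \<forall>y\<in>compact_ops. T (x + y) = T x + T y) \<and>
     (\<forall>c. \<forall>x\<in>compact_ops. T (op_scaleC c x) = op_scaleC c (T x)) \<and>
     (\<forall>x\<in>compact_ops. \<forall>d\<in>D. T (x o\<^sub>L d) = T x o\<^sub>L d)"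

definition map_norm ::
    "(('a::complex_hilbert_space \<Rightarrow>\<^sub>L 'a) \<Rightarrow> ('a \<Rightarrow>\<^sub>L 'a)) \<Rightarrow> ennreal" where
  "map_norm T = (SUP x\<in>{x \<in> compact_ops. norm x \<le> 1}. ennreal (norm (T x)))"

text \<open>
  An \<open>n \<times> n\<close> operator matrix is a function \<open>X\<close> of which only the entries \<open>X i j\<close> with \<open>i, j < n\<close>
  matter; a vector of \<open>H\<^sup>n\<close> is likewise a function \<open>\<xi>\<close> restricted to \<open>{..<n}\<close>, with norm
  \<open>L2_set (\<lambda>j. norm (\<xi> j)) {..<n}\<close>. The matrix norm is the operator norm on \<open>H\<^sup>n\<close>.
\<close>

definition mat_norm :: "nat \<Rightarrow> (nat \<Rightarrow> nat \<Rightarrow> 'a::complex_hilbert_space \<Rightarrow>\<^sub>L 'a) \<Rightarrow> real" where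
  "mat_norm n X =
     (SUP \<xi>\<in>{\<xi>. L2_set (\<lambda>j. norm (\<xi> j)) {..<n} \<le> 1}.
        L2_set (\<lambda>i. norm (\<Sum>j<n. blinfun_apply (X i j) (\<xi> j))) {..<n})"

lemma mat_norm_bdd_above:
  fixes X :: "nat \<Rightarrow> nat \<Rightarrow> 'a::complex_hilbert_space \<Rightarrow>\<^sub>L 'a"
  shows "bdd_above ((\<lambda>\<xi>. L2_set (\<lambda>i. norm (\<Sum>j<n. blinfun_apply (X i j) (\<xi> j))) {..<n})
           ` {\<xi>. L2_set (\<lambda>j. norm (\<xi> j)) {..<n} \<le> 1})"
proof (rule bdd_aboveI2)
  fix \<xi> :: "nat \<Rightarrow> 'a"
  assume "\<xi> \<in> {\<xi>. L2_set (\<lambda>j. norm (\<xi> j)) {..<n} \<le> 1}"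
  then have le: "norm (\<xi> j) \<le> 1" if "j < n" for j
    using member_le_L2_set[of "{..<n}" j "\<lambda>j. norm (\<xi> j)"] that by force
  have "L2_set (\<lambda>i. norm (\<Sum>j<n. blinfun_apply (X i j) (\<xi> j))) {..<n}
      \<le> (\<Sum>i<n. norm (\<Sum>j<n. blinfun_apply (X i j) (\<xi> j)))"
    by (rule L2_set_le_sum) simp
  also have "\<dots> \<le> (\<Sum>i<n. \<Sum>j<n. norm (X i j))"
  proof (intro sum_mono order_trans[OF norm_sum])
    fix i j assume "j \<in> {..<n}"
    then have "norm (X i j) * norm (\<xi> j) \<le> norm (X i j) * 1"
      by (intro mult_left_mono le) auto
    then show "norm (blinfun_apply (X i j) (\<xi> j)) \<le> norm (X i j)"
      using norm_blinfun[of "X i j" "\<xi> j"] by simp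
  qed
  finally show "L2_set (\<lambda>i. norm (\<Sum>j<n. blinfun_apply (X i j) (\<xi> j))) {..<n}
      \<le> (\<Sum>i<n. \<Sum>j<n. norm (X i j))" .
qed

definition amplification_norm ::
    "nat \<Rightarrow> (('a::complex_hilbert_space \<Rightarrow>\<^sub>L 'a) \<Rightarrow> ('a \<Rightarrow>\<^sub>L 'a)) \<Rightarrow> ennreal" where
  "amplification_norm n T =
     (SUP X\<in>{X. (\<forall>i<n. \<forall>j<n. X i j \<in> compact_ops) \<and> mat_norm n X \<le> 1}.
        ennreal (mat_norm n (\<lambda>i j. T (X i j))))"

definition cb_norm ::
    "(('a::complex_hilbert_space \<Rightarrow>\<^sub>L 'a) \<Rightarrow> ('a \<Rightarrow>\<^sub>L 'a)) \<Rightarrow> ennreal" where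
  "cb_norm T = (SUP n\<in>{1..}. amplification_norm n T)"

definition bounded_map ::
    "(('a::complex_hilbert_space \<Rightarrow>\<^sub>L 'a) \<Rightarrow> ('a \<Rightarrow>\<^sub>L 'a)) \<Rightarrow> bool" where
  "bounded_map T \<longleftrightarrow> map_norm T < \<infinity>"

definition completely_bounded ::
    "(('a::complex_hilbert_space \<Rightarrow>\<^sub>L 'a) \<Rightarrow> ('a \<Rightarrow>\<^sub>L 'a)) \<Rightarrow> bool" where
  "completely_bounded T \<longleftrightarrow> cb_norm T < \<infinity>"

end

theory Submission
  imports Defs
begin

text \<open>
  Let \<open>(p\<^sub>k)\<close> be orthogonal projections in \<open>D\<close>, \<open>(e\<^sub>j)\<close> an orthonormal sequence and \<open>\<sigma>\<close> the
  projection onto the span of \<open>2d\<close> of the \<open>e\<^sub>j\<close>. Every map \<open>x \<mapsto> \<Sum>\<^sub>k W\<^sub>k \<sigma> x p\<^sub>k\<close> is a right \<open>D\<close>-module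
  map because each \<open>p\<^sub>k\<close> commutes with \<open>D\<close>. If the \<open>W\<^sub>k\<close> are contractions, its norm is at most
  \<open>\<surd>(2d)\<close> however many terms there are: the operators \<open>\<sigma> x p\<^sub>k\<close> are the columns of \<open>\<sigma> x\<close>, whose
  Hilbert-Schmidt norm is at most \<open>\<surd>(2d) \<parallel>x\<parallel>\<close>, and applying a contraction to each column does not
  increase that norm (lemma \<open>column_map_bound\<close>).

  The completely bounded norm does see the number of terms. On a space of dimension \<open>d\<close> there are
  \<open>d\<^sup>2\<close> unitaries which are orthogonal for the trace, namely the products of shifts and diagonal
  Fourier characters. If the \<open>W\<^sub>k\<close> are modelled on these, the vectors
  \<open>(W\<^sub>k\<^sup>* \<otimes> 1) (\<Sum>\<^sub>i e\<^sub>i \<otimes> e\<^sub>i) / \<surd>d\<close> form an orthonormal family of \<open>d\<^sup>2\<close> elements of \<open>H\<^sup>d\<close>, so the operator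
  with these columns is a contraction (lemma \<open>fourier_column_contractive\<close>). The amplified map sends
  all \<open>d\<^sup>2\<close> columns to the same unit vector, which produces norm \<open>\<surd>(d\<^sup>2) = d\<close>. After division by \<open>\<surd>d\<close>
  there remain the bound \<open>\<surd>2\<close> for the norm (lemma \<open>fourier_block_norm\<close>) and the lower bound \<open>\<surd>d\<close>
  for the completely bounded norm (lemma \<open>fourier_block_column_norm\<close>). Weighted by \<open>2\<^bsup>-m\<^esup>\<close>, blocks of
  size \<open>d = 16\<^sup>m\<close> living on disjoint sets of columns add up to a bounded module map which is not
  completely bounded. It maps into the compact operators because the series converges in norm.

  The construction needs infinitely many orthogonal nonzero projections in \<open>D\<close>, and these exist in
  every masa of an infinite-dimensional space (lemma \<open>masa_orthogonal_projections\<close>). By maximality,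
  \<open>D\<close> contains the projection onto each closed \<open>D\<close>-invariant subspace. If \<open>A \<in> D\<close> is self-adjoint and
  \<open>S\<close> is its absolute value, then \<open>(S - A) (S + A) = 0\<close>, so \<open>ker (S - A)\<close> is such a subspace, and it
  splits \<open>p H\<close> for a projection \<open>p \<in> D\<close> unless \<open>A\<close> has a sign on \<open>p H\<close>. If \<open>p\<close> is minimal in \<open>D\<close>, this
  applies to all \<open>A - t\<close>, so \<open>A\<close> is a scalar on \<open>p H\<close> and \<open>p H\<close> has dimension at most one. Hence a
  projection of infinite rank is never minimal and can be split for ever.
\<close>

section \<open>Complex inner product spaces\<close>

lemma cinner_scaleC_right: "cinner x (a *\<^sub>C y) = cnj a * cinner x (y :: 'a::complex_hilbert_space)"
  by (metis cinner_commute cinner_scaleC_left complex_cnj_mult)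

lemma cinner_add_right: "cinner x (y + z) = cinner x y + cinner x (z :: 'a::complex_hilbert_space)"
  by (metis cinner_commute cinner_add_left complex_cnj_add)

lemma cinner_self: "cinner x x = complex_of_real ((norm (x :: 'a::complex_hilbert_space))\<^sup>2)"
proof -
  have "Im (cinner x x) = 0"
    using cinner_commute[of x x] by (metis add.inverse_inverse cnj.simps(2) equal_neg_zero)
  then show ?thesis
    by (simp add: complex_eq_iff norm_eq_sqrt_cinner cinner_self_nonneg)
qed

lemma norm_square: "(norm (x :: 'a::complex_hilbert_space))\<^sup>2 = Re (cinner x x)"
  by (simp add: cinner_self)

lemma norm_add_square:
  "(norm (x + y :: 'a::complex_hilbert_space))\<^sup>2 = (norm x)\<^sup>2 + 2 * Re (cinner x y) + (norm y)\<^sup>2"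
proof -
  have "Re (cinner y x) = Re (cinner x y)"
    by (metis cinner_commute complex_cnj cnj.simps(1))
  then show ?thesis
    unfolding norm_square by (simp add: cinner_add_left cinner_add_right)
qed

text \<open>
  The minimum of \<open>\<parallel>x + a y\<parallel>\<^sup>2\<close> over the scalars \<open>a\<close>. That it is nonnegative is the Cauchy-Schwarz
  inequality; that it cannot be smaller than \<open>\<parallel>x\<parallel>\<^sup>2\<close> when \<open>x\<close> is the shortest vector of a coset forces
  orthogonality to \<open>y\<close>.
\<close>

lemma norm_component_removed:
  fixes x y :: "'a::complex_hilbert_space"
  assumes "y \<noteq> 0"
  shows "(norm (x + (- (cinner x y / complex_of_real ((norm y)\<^sup>2))) *\<^sub>C y))\<^sup>2
    = (norm x)\<^sup>2 - (cmod (cinner x y))\<^sup>2 / (norm y)\<^sup>2"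
proof -
  define c where "c = cinner x y"
  define s where "s = (norm y)\<^sup>2"
  define a where "a = - (c / complex_of_real s)"
  have s: "s > 0" using assms by (simp add: s_def)
  have "(norm (x + a *\<^sub>C y))\<^sup>2 = (norm x)\<^sup>2 + 2 * Re (cnj a * c) + (cmod a)\<^sup>2 * s"
    by (simp add: norm_add_square cinner_scaleC_right c_def s_def norm_scaleC power_mult_distrib)
  also have "cnj a * c = - complex_of_real ((cmod c)\<^sup>2 / s)"
    using complex_norm_square[of c] by (simp add: a_def mult.commute)
  also have "(cmod a)\<^sup>2 * s = (cmod c)\<^sup>2 / s"
    using s by (simp add: a_def norm_divide power_divide power2_eq_square)
  finally show ?thesis by (simp add: a_def c_def s_def)
qed

lemma Cauchy_Schwarz_cinner: "cmod (cinner x (y :: 'a::complex_hilbert_space)) \<le> norm x * norm y"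
proof (cases "y = 0")
  case True
  then show ?thesis
    using cinner_scaleC_right[of x 0 0] by simp
next
  case False
  have "0 \<le> (norm x)\<^sup>2 - (cmod (cinner x y))\<^sup>2 / (norm y)\<^sup>2"
    unfolding norm_component_removed[OF False, symmetric] by simp
  then have "(cmod (cinner x y))\<^sup>2 \<le> (norm x * norm y)\<^sup>2"
    using False by (simp add: field_simps power_mult_distrib)
  then show ?thesis
    by (rule power2_le_imp_le) simp
qed

interpretation cinner: bounded_bilinear "cinner :: 'a::complex_hilbert_space \<Rightarrow> 'a \<Rightarrow> complex"
proof
  fix r :: real and x y :: 'a
  show "cinner (r *\<^sub>R x) y = r *\<^sub>R cinner x y"
    by (simp add: scaleR_scaleC cinner_scaleC_left scaleR_conv_of_real)
  show "cinner x (r *\<^sub>R y) = r *\<^sub>R cinner x y"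
    by (simp add: scaleR_scaleC cinner_scaleC_right scaleR_conv_of_real)
  show "\<exists>K. \<forall>x y :: 'a. norm (cinner x y) \<le> norm x * norm y * K"
    using Cauchy_Schwarz_cinner by (intro exI[of _ 1]) auto
qed (simp_all add: cinner_add_left cinner_add_right)

lemma norm_sum_orthogonal:
  fixes v :: "'i \<Rightarrow> 'a::complex_hilbert_space"
  assumes "finite K" "\<And>k l. k \<in> K \<Longrightarrow> l \<in> K \<Longrightarrow> k \<noteq> l \<Longrightarrow> cinner (v k) (v l) = 0"
  shows "(norm (\<Sum>k\<in>K. v k))\<^sup>2 = (\<Sum>k\<in>K. (norm (v k))\<^sup>2)"
  using assms
proof (induction K rule: finite_induct)
  case (insert k K)
  have "cinner (v k) (\<Sum>l\<in>K. v l) = 0"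
    unfolding cinner.sum_right using insert by (intro sum.neutral) auto
  then show ?case
    using insert by (simp add: norm_add_square)
qed simp

text \<open>
  Stated for orthogonal vectors of arbitrary length, so that it covers both the coefficients with
  respect to an orthonormal family and the images of \<open>h\<close> under orthogonal projections.
\<close>

lemma Bessel_inequality:
  fixes v :: "'i \<Rightarrow> 'a::complex_hilbert_space"
  assumes "finite K" "\<And>k l. k \<in> K \<Longrightarrow> l \<in> K \<Longrightarrow> k \<noteq> l \<Longrightarrow> cinner (v k) (v l) = 0"
    and v: "\<And>k. k \<in> K \<Longrightarrow> cinner h (v k) = complex_of_real ((norm (v k))\<^sup>2)"
  shows "(\<Sum>k\<in>K. (norm (v k))\<^sup>2) \<le> (norm h)\<^sup>2"
proof -
  let ?s = "norm (\<Sum>k\<in>K. v k)"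
  have s: "?s\<^sup>2 = (\<Sum>k\<in>K. (norm (v k))\<^sup>2)"
    by (rule norm_sum_orthogonal) (use assms in auto)
  have "cinner h (\<Sum>k\<in>K. v k) = complex_of_real (?s\<^sup>2)"
    by (simp only: cinner.sum_right s of_real_sum) (simp add: v)
  then have "?s\<^sup>2 \<le> norm h * ?s"
    using Cauchy_Schwarz_cinner[of h "\<Sum>k\<in>K. v k"] by (simp add: norm_power)
  then have "?s \<le> norm h"
    by (cases "?s = 0") (auto simp: power2_eq_square)
  then show ?thesis
    unfolding s[symmetric] by (rule power_mono) simp
qed

lemma orthonormal_combination_norm:
  fixes e :: "'i \<Rightarrow> 'a::complex_hilbert_space"
  assumes "finite K" "\<And>k l. k \<in> K \<Longrightarrow> l \<in> K \<Longrightarrow> cinner (e k) (e l) = (if k = l then 1 else 0)"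
  shows "(norm (\<Sum>k\<in>K. c k *\<^sub>C e k))\<^sup>2 = (\<Sum>k\<in>K. (cmod (c k))\<^sup>2)"
proof -
  have "norm (e k) = 1" if "k \<in> K" for k
    using assms(2)[OF that that] by (simp add: norm_eq_sqrt_cinner)
  moreover have "(norm (\<Sum>k\<in>K. c k *\<^sub>C e k))\<^sup>2 = (\<Sum>k\<in>K. (norm (c k *\<^sub>C e k))\<^sup>2)"
    using assms by (intro norm_sum_orthogonal) (auto simp: cinner_scaleC_left cinner_scaleC_right)
  ultimately show ?thesis by (simp add: norm_scaleC)
qed

lemma orthonormal_Bessel:
  fixes e :: "'i \<Rightarrow> 'a::complex_hilbert_space"
  assumes "finite K" "\<And>k l. k \<in> K \<Longrightarrow> l \<in> K \<Longrightarrow> cinner (e k) (e l) = (if k = l then 1 else 0)"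
  shows "(\<Sum>k\<in>K. (cmod (cinner h (e k)))\<^sup>2) \<le> (norm h)\<^sup>2"
proof -
  have e: "norm (e k) = 1" if "k \<in> K" for k
    using assms(2)[OF that that] by (simp add: norm_eq_sqrt_cinner)
  have "(\<Sum>k\<in>K. (norm (cinner h (e k) *\<^sub>C e k))\<^sup>2) \<le> (norm h)\<^sup>2"
    using assms e
    by (intro Bessel_inequality)
       (auto simp: cinner_scaleC_left cinner_scaleC_right norm_scaleC complex_norm_square mult.commute simp del: of_real_power)
  then show ?thesis using e by (simp add: norm_scaleC)
qed

section \<open>Bounded and compact operators\<close>

lemma bounded_ops_scaleC: "A \<in> bounded_ops \<Longrightarrow> blinfun_apply A (c *\<^sub>C x) = c *\<^sub>C blinfun_apply A x"
  by (simp add: bounded_ops_def)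

lemma bounded_ops_compose: "A \<in> bounded_ops \<Longrightarrow> B \<in> bounded_ops \<Longrightarrow> A o\<^sub>L B \<in> bounded_ops"
  by (simp add: bounded_ops_def)

lemma bounded_ops_add: "A \<in> bounded_ops \<Longrightarrow> B \<in> bounded_ops \<Longrightarrow> A + B \<in> bounded_ops"
  by (simp add: bounded_ops_def blinfun.add_left scaleC_add_right)

lemma bounded_ops_op_scaleC: "A \<in> bounded_ops \<Longrightarrow> op_scaleC c A \<in> bounded_ops"
  by (simp add: bounded_ops_def op_scaleC_apply scaleC_scaleC mult.commute)

lemma bounded_ops_sum: "(\<And>k. k \<in> K \<Longrightarrow> A k \<in> bounded_ops) \<Longrightarrow> (\<Sum>k\<in>K. A k) \<in> bounded_ops"
  by (simp add: bounded_ops_def blinfun.sum_left complex_vector.scale_sum_right)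

lemma bounded_ops_limit:
  assumes "\<And>n. A n \<in> bounded_ops" "A \<longlonglongrightarrow> B"
  shows "B \<in> bounded_ops"
  unfolding bounded_ops_def
proof safe
  fix c :: complex and x :: 'a
  have lim: "(\<lambda>n. A n y) \<longlonglongrightarrow> B y" for y
    by (intro tendsto_intros assms)
  have "(\<lambda>n. c *\<^sub>C A n x) \<longlonglongrightarrow> c *\<^sub>C B x"
    by (rule bounded_linear.tendsto[OF bounded_linear_scaleC lim])
  then have "(\<lambda>n. A n (c *\<^sub>C x)) \<longlonglongrightarrow> c *\<^sub>C B x"
    using assms by (simp add: bounded_ops_scaleC)
  with lim show "B (c *\<^sub>C x) = c *\<^sub>C B x" by (rule LIMSEQ_unique)
qed

interpretation blinfun_compose: bounded_bilinear
  "(o\<^sub>L) :: ('b::real_normed_vector \<Rightarrow>\<^sub>L 'c::real_normed_vector) \<Rightarrow> ('a::real_normed_vector \<Rightarrow>\<^sub>L 'b) \<Rightarrow> 'a \<Rightarrow>\<^sub>L 'c"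
  by (rule bounded_bilinear_blinfun_compose)

lemma blinfun_compose_assoc: "(A o\<^sub>L B) o\<^sub>L C = A o\<^sub>L (B o\<^sub>L C)"
  by (rule blinfun_eqI) simp

lemma blinfun_compose_id: "A o\<^sub>L id_blinfun = A" "id_blinfun o\<^sub>L A = A"
  by (rule blinfun_eqI, simp)+

lemma compact_opsI:
  assumes "A \<in> bounded_ops" "compact C" "blinfun_apply A ` cball 0 1 \<subseteq> C"
  shows "A \<in> compact_ops"
proof -
  have "closure (blinfun_apply A ` cball 0 1) \<subseteq> C"
    using assms compact_imp_closed closure_minimal by blast
  then have "compact (closure (blinfun_apply A ` cball 0 1))"
    using \<open>compact C\<close> by (metis closed_Int_compact closed_closure inf.absorb_iff1)
  with assms show ?thesis by (simp add: compact_ops_def)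
qed

lemma compact_opsE:
  assumes "A \<in> compact_ops"
  obtains C where "A \<in> bounded_ops" "compact C" "blinfun_apply A ` cball 0 1 \<subseteq> C"
  using assms that[OF _ _ closure_subset] by (simp add: compact_ops_def)

lemma compact_ops_0: "0 \<in> compact_ops"
  by (rule compact_opsI[of _ "{0}"]) (auto simp: bounded_ops_def)

lemma compact_ops_add:
  assumes "A \<in> compact_ops" "B \<in> compact_ops"
  shows "A + B \<in> compact_ops"
proof -
  obtain C where C: "A \<in> bounded_ops" "compact C" "blinfun_apply A ` cball 0 1 \<subseteq> C"
    using assms(1) by (rule compact_opsE)
  obtain C' where C': "B \<in> bounded_ops" "compact C'" "blinfun_apply B ` cball 0 1 \<subseteq> C'"
    using assms(2) by (rule compact_opsE)
  show ?thesis
  proof (rule compact_opsI)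
    show "compact {x + y | x y. x \<in> C \<and> y \<in> C'}"
      using C C' by (intro compact_sums)
    show "blinfun_apply (A + B) ` cball 0 1 \<subseteq> {x + y | x y. x \<in> C \<and> y \<in> C'}"
      using C C' unfolding blinfun.add_left by blast
  qed (use C C' bounded_ops_add in blast)
qed

lemma compact_ops_sum:
  "(\<And>k. k \<in> K \<Longrightarrow> A k \<in> compact_ops) \<Longrightarrow> (\<Sum>k\<in>K. A k) \<in> compact_ops"
  by (induction K rule: infinite_finite_induct) (auto intro: compact_ops_0 compact_ops_add)

lemma compact_ops_compose_left:
  assumes "B \<in> bounded_ops" "A \<in> compact_ops"
  shows "B o\<^sub>L A \<in> compact_ops"
proof -
  obtain C where C: "A \<in> bounded_ops" "compact C" "blinfun_apply A ` cball 0 1 \<subseteq> C"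
    using assms(2) by (rule compact_opsE)
  have "compact (blinfun_apply B ` C)"
    by (rule compact_continuous_image[OF linear_continuous_on[OF blinfun.bounded_linear_right] C(2)])
  then show ?thesis
    by (rule compact_opsI[rotated]) (use C assms bounded_ops_compose in auto)
qed

lemma compact_ops_compose_right:
  assumes "A \<in> compact_ops" "B \<in> bounded_ops"
  shows "A o\<^sub>L B \<in> compact_ops"
proof -
  obtain C where C: "A \<in> bounded_ops" "compact C" "blinfun_apply A ` cball 0 1 \<subseteq> C"
    using assms(1) by (rule compact_opsE)
  define r where "r = norm B + 1"
  have r: "r > 0" by (simp add: r_def add_nonneg_pos)
  show ?thesis
  proof (rule compact_opsI)
    show "compact ((*\<^sub>R) r ` C)"
      by (rule compact_scaling[OF C(2)])
    show "blinfun_apply (A o\<^sub>L B) ` cball 0 1 \<subseteq> (*\<^sub>R) r ` C"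
    proof clarsimp
      fix x :: 'a assume "norm x \<le> 1"
      have "norm (B x) \<le> norm B * norm x" by (rule norm_blinfun)
      also have "\<dots> \<le> r * 1" using \<open>norm x \<le> 1\<close> r by (intro mult_mono) (auto simp: r_def)
      finally have "norm ((1 / r) *\<^sub>R B x) \<le> 1" using r by (simp add: field_simps)
      then have "A ((1 / r) *\<^sub>R B x) \<in> C" using C by auto
      moreover have "A (B x) = r *\<^sub>R A ((1 / r) *\<^sub>R B x)"
        using r by (simp add: blinfun.scaleR_right)
      ultimately show "A (B x) \<in> (*\<^sub>R) r ` C" by blast
    qed
  qed (use C assms bounded_ops_compose in blast)
qed

lemma compact_ops_op_scaleC: "A \<in> compact_ops \<Longrightarrow> op_scaleC c A \<in> compact_ops"
proof -
  assume A: "A \<in> compact_ops"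
  have "op_scaleC c A = op_scaleC c id_blinfun o\<^sub>L A"
    by (rule blinfun_eqI) (simp add: op_scaleC_apply)
  moreover have "op_scaleC c id_blinfun \<in> bounded_ops"
    by (intro bounded_ops_op_scaleC) (simp add: bounded_ops_def)
  ultimately show ?thesis
    using A compact_ops_compose_left by metis
qed

lemma compact_ops_scaleR: "A \<in> compact_ops \<Longrightarrow> r *\<^sub>R A \<in> compact_ops"
proof -
  have "r *\<^sub>R A = op_scaleC (complex_of_real r) A"
    by (rule blinfun_eqI) (simp add: blinfun.scaleR_left op_scaleC_apply scaleR_scaleC)
  then show "A \<in> compact_ops \<Longrightarrow> r *\<^sub>R A \<in> compact_ops"
    by (simp add: compact_ops_op_scaleC)
qed

text \<open>
  Total boundedness of the image of the unit ball survives a uniformly small perturbation.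
\<close>

lemma compact_ops_limit:
  assumes A: "\<And>n. A n \<in> compact_ops" and lim: "A \<longlonglongrightarrow> B"
  shows "B \<in> compact_ops"
proof -
  have "B \<in> bounded_ops"
    by (rule bounded_ops_limit[OF _ lim]) (use A in \<open>auto simp: compact_ops_def\<close>)
  moreover have "compact (closure (blinfun_apply B ` cball 0 1))"
    unfolding compact_eq_totally_bounded
  proof safe
    show "complete (closure (blinfun_apply B ` cball 0 1))"
      by (simp add: complete_eq_closed)
    fix e :: real assume "e > 0"
    then obtain n where n: "norm (A n - B) < e / 3"
      using LIMSEQ_D[OF lim, of "e / 3"] by auto
    obtain C where C: "compact C" "blinfun_apply (A n) ` cball 0 1 \<subseteq> C"
      using A compact_opsE by metis
    obtain k where k: "finite k" "C \<subseteq> (\<Union>x\<in>k. ball x (e / 3))"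
      using C(1) \<open>e > 0\<close> unfolding compact_eq_totally_bounded by (metis divide_pos_pos zero_less_numeral)
    have "closure (blinfun_apply B ` cball 0 1) \<subseteq> (\<Union>x\<in>k. cball x (2 * e / 3))"
    proof (rule closure_minimal)
      show "closed (\<Union>x\<in>k. cball x (2 * e / 3))"
        using k by (intro closed_UN) auto
      show "blinfun_apply B ` cball 0 1 \<subseteq> (\<Union>x\<in>k. cball x (2 * e / 3))"
      proof (rule image_subsetI)
        fix x :: 'a assume x: "x \<in> cball 0 1"
        then have "A n x \<in> C" using C by auto
        then obtain y where y: "y \<in> k" "dist y (A n x) < e / 3" using k by auto
        have "norm ((A n - B) x) \<le> norm (A n - B) * norm x" by (rule norm_blinfun)
        also have "\<dots> \<le> e / 3 * 1" using n x \<open>e > 0\<close> by (intro mult_mono) auto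
        finally have "dist (A n x) (B x) \<le> e / 3" by (simp add: dist_norm blinfun.diff_left)
        then have "dist y (B x) \<le> 2 * e / 3" using y dist_triangle[of y "B x" "A n x"] by simp
        with y show "B x \<in> (\<Union>x\<in>k. cball x (2 * e / 3))" by auto
      qed
    qed
    also have "\<dots> \<subseteq> (\<Union>x\<in>k. ball x e)" using \<open>e > 0\<close> by force
    finally show "\<exists>k. finite k \<and> closure (blinfun_apply B ` cball 0 1) \<subseteq> (\<Union>x\<in>k. ball x e)"
      using k by blast
  qed
  ultimately show ?thesis by (simp add: compact_ops_def)
qed

definition rank_one :: "'a::complex_hilbert_space \<Rightarrow> 'a \<Rightarrow> 'a \<Rightarrow>\<^sub>L 'a" where
  "rank_one g f = Blinfun (\<lambda>h. cinner h f *\<^sub>C g)"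

lemma rank_one_apply: "blinfun_apply (rank_one g f) h = cinner h f *\<^sub>C g"
proof -
  have "bounded_linear (\<lambda>h. cinner h f *\<^sub>C g)"
  proof (rule bounded_linear_intro[where K = "norm f * norm g"])
    fix h k :: 'a and r :: real
    show "cinner (h + k) f *\<^sub>C g = cinner h f *\<^sub>C g + cinner k f *\<^sub>C g"
      by (simp add: cinner_add_left scaleC_add_left)
    show "cinner (r *\<^sub>R h) f *\<^sub>C g = r *\<^sub>R cinner h f *\<^sub>C g"
      by (simp add: scaleR_scaleC scaleC_scaleC cinner_scaleC_left)
    show "norm (cinner h f *\<^sub>C g) \<le> norm h * (norm f * norm g)"
      unfolding norm_scaleC mult.assoc[symmetric]
      by (intro mult_right_mono Cauchy_Schwarz_cinner) simp
  qed
  then show ?thesis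
    unfolding rank_one_def by (simp add: bounded_linear_Blinfun_apply)
qed

lemma rank_one_bounded: "rank_one g f \<in> bounded_ops"
  by (simp add: bounded_ops_def rank_one_apply cinner_scaleC_left scaleC_scaleC)

lemma rank_one_compact: "rank_one g f \<in> compact_ops"
proof (rule compact_opsI[OF rank_one_bounded])
  have "bounded_linear (\<lambda>c :: complex. c *\<^sub>C g)"
    by (rule bounded_linear_intro[where K = "norm g"])
       (simp_all add: scaleC_add_left scaleR_scaleC scaleC_scaleC norm_scaleC scaleR_conv_of_real)
  then show "compact ((\<lambda>c. c *\<^sub>C g) ` cball 0 (norm f))"
    by (intro compact_continuous_image linear_continuous_on) auto
  show "blinfun_apply (rank_one g f) ` cball 0 1 \<subseteq> (\<lambda>c. c *\<^sub>C g) ` cball 0 (norm f)"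
  proof clarsimp
    fix h :: 'a assume "norm h \<le> 1"
    have "cmod (cinner h f) \<le> norm h * norm f" by (rule Cauchy_Schwarz_cinner)
    also have "\<dots> \<le> 1 * norm f" by (intro mult_right_mono) (use \<open>norm h \<le> 1\<close> in auto)
    finally show "rank_one g f h \<in> (\<lambda>c. c *\<^sub>C g) ` cball 0 (norm f)"
      unfolding rank_one_apply by (intro imageI) simp
  qed
qed

section \<open>Orthogonal projections\<close>

lemma is_adjointD: "is_adjoint A B \<Longrightarrow> cinner (blinfun_apply A x) y = cinner x (blinfun_apply B y)"
  by (simp add: is_adjoint_def)

lemma is_adjoint_sym: "is_adjoint A B \<Longrightarrow> is_adjoint B A"
  unfolding is_adjoint_def by (metis cinner_commute)

definition selfadjoint_idempotent :: "('a::complex_hilbert_space \<Rightarrow>\<^sub>L 'a) \<Rightarrow> bool" where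
  "selfadjoint_idempotent p \<longleftrightarrow> p \<in> bounded_ops \<and> is_adjoint p p \<and> p o\<^sub>L p = p"

lemma selfadjoint_idempotent_apply: "selfadjoint_idempotent p \<Longrightarrow> p (p v) = p v"
  unfolding selfadjoint_idempotent_def by (metis blinfun_apply_blinfun_compose)

lemma selfadjoint_idempotent_cinner:
  "selfadjoint_idempotent p \<Longrightarrow> cinner v (p v) = complex_of_real ((norm (p v))\<^sup>2)"
  unfolding cinner_self[symmetric]
  by (metis is_adjointD selfadjoint_idempotent_apply selfadjoint_idempotent_def)

lemma selfadjoint_idempotent_orthogonal:
  assumes "selfadjoint_idempotent p" "p o\<^sub>L q = 0"
  shows "cinner (p v) (q w) = 0"
proof -
  have "cinner (p v) (q w) = cinner v ((p o\<^sub>L q) w)"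
    using assms(1) by (simp add: selfadjoint_idempotent_def is_adjointD)
  then show ?thesis using assms(2) by (simp add: cinner.zero_right)
qed

text \<open>
  A minimising sequence for the distance from \<open>x\<close> to \<open>N\<close> is Cauchy by the parallelogram law, and the
  variation of the squared distance along \<open>z\<close> vanishes at the minimum.
\<close>

lemma closed_subspace_nearest_point:
  fixes N :: "'a::complex_hilbert_space set"
  assumes "closed N" and N: "complex_vector.subspace N"
  obtains y where "y \<in> N" "\<And>z. z \<in> N \<Longrightarrow> cinner (x - y) z = 0"
proof -
  define dd where "dd = (INF y\<in>N. (norm (x - y))\<^sup>2)"
  have Nadd: "u + v \<in> N" if "u \<in> N" "v \<in> N" for u v
    using N that by (rule complex_vector.subspace_add)
  have Nsc: "c *\<^sub>C u \<in> N" if "u \<in> N" for u c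
    using N that by (rule complex_vector.subspace_scale)
  have Nne: "N \<noteq> {}" using N by (auto simp: complex_vector.subspace_def)
  have Nsum: "(1 / 2) *\<^sub>R (u + v) \<in> N" if "u \<in> N" "v \<in> N" for u v
    unfolding scaleR_scaleC using Nsc[OF Nadd[OF that]] .
  have dd: "dd \<le> (norm (x - y))\<^sup>2" if "y \<in> N" for y
    unfolding dd_def by (rule cINF_lower[OF _ that]) (auto intro!: bdd_belowI2[of _ 0])
  have "\<exists>y\<in>N. (norm (x - y))\<^sup>2 < dd + inverse (real (Suc n))" for n
    using cInf_lessD[of "(\<lambda>y. (norm (x - y))\<^sup>2) ` N" "dd + inverse (real (Suc n))"] Nne
    by (auto simp: dd_def)
  then obtain s where s: "\<And>n. s n \<in> N" "\<And>n. (norm (x - s n))\<^sup>2 < dd + inverse (real (Suc n))"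
    by metis
  have par: "(norm (s n - s m))\<^sup>2 \<le> 2 * inverse (real (Suc n)) + 2 * inverse (real (Suc m))" for n m
  proof -
    define u v where "u = x - s n" and "v = x - s m"
    have "(norm (u + v))\<^sup>2 + (norm (u - v))\<^sup>2 = 2 * (norm u)\<^sup>2 + 2 * (norm v)\<^sup>2"
      using norm_add_square[of u v] norm_add_square[of u "- v"] by (simp add: cinner.minus_right)
    moreover have "u + v = 2 *\<^sub>R (x - (1 / 2) *\<^sub>R (s n + s m))"
      by (simp add: u_def v_def algebra_simps scaleR_2)
    then have "(norm (u + v))\<^sup>2 = 4 * (norm (x - (1 / 2) *\<^sub>R (s n + s m)))\<^sup>2"
      by (simp add: power_mult_distrib)
    moreover have "dd \<le> (norm (x - (1 / 2) *\<^sub>R (s n + s m)))\<^sup>2"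
      by (intro dd Nsum s)
    moreover have "(norm (u - v))\<^sup>2 = (norm (s n - s m))\<^sup>2"
      by (simp add: u_def v_def norm_minus_commute)
    ultimately show ?thesis
      using s(2)[of n] s(2)[of m] unfolding u_def v_def by linarith
  qed
  have "Cauchy s"
    unfolding Cauchy_def dist_norm
  proof safe
    fix e :: real assume "e > 0"
    then have "e\<^sup>2 / 4 > 0" by simp
    then obtain M where M: "inverse (real (Suc M)) < e\<^sup>2 / 4"
      using reals_Archimedean by blast
    have inv: "inverse (real (Suc n)) < e\<^sup>2 / 4" if "n \<ge> M" for n
    proof -
      have "inverse (real (Suc n)) \<le> inverse (real (Suc M))"
        using that by (intro le_imp_inverse_le) auto
      with M show ?thesis by linarith
    qed
    have "norm (s m - s n) < e" if "m \<ge> M" "n \<ge> M" for m n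
    proof (rule power2_less_imp_less)
      show "(norm (s m - s n))\<^sup>2 < e\<^sup>2"
        using par[of m n] inv[OF that(1)] inv[OF that(2)] by linarith
    qed (use \<open>e > 0\<close> in simp)
    then show "\<exists>M. \<forall>m\<ge>M. \<forall>n\<ge>M. norm (s m - s n) < e" by blast
  qed
  then obtain y where y: "s \<longlonglongrightarrow> y"
    using Cauchy_convergent_iff convergent_def by blast
  have "y \<in> N"
    by (rule closed_sequentially[OF \<open>closed N\<close> s(1) y])
  have ymin: "(norm (x - y))\<^sup>2 \<le> dd"
  proof (rule LIMSEQ_le)
    show "(\<lambda>n. (norm (x - s n))\<^sup>2) \<longlonglongrightarrow> (norm (x - y))\<^sup>2"
      by (intro tendsto_intros y)
    show "(\<lambda>n. dd + inverse (real (Suc n))) \<longlonglongrightarrow> dd"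
      using tendsto_add[OF tendsto_const LIMSEQ_inverse_real_of_nat] by simp
  qed (use s(2) less_imp_le in blast)
  have "cinner (x - y) z = 0" if "z \<in> N" for z
  proof (cases "z = 0")
    case False
    define a where "a = cinner (x - y) z / complex_of_real ((norm z)\<^sup>2)"
    have "(norm (x - y))\<^sup>2 \<le> (norm (x - (y + a *\<^sub>C z)))\<^sup>2"
      using ymin dd[OF Nadd[OF \<open>y \<in> N\<close> Nsc[OF that]], of a] by linarith
    also have "x - (y + a *\<^sub>C z) = (x - y) + (- a) *\<^sub>C z"
      by (simp add: algebra_simps)
    also have "(norm ((x - y) + (- a) *\<^sub>C z))\<^sup>2 = (norm (x - y))\<^sup>2 - (cmod (cinner (x - y) z))\<^sup>2 / (norm z)\<^sup>2"
      using norm_component_removed[OF False, of "x - y"] by (simp add: a_def)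
    finally show ?thesis using False by (simp add: divide_le_0_iff)
  qed (simp add: cinner.zero_right)
  with \<open>y \<in> N\<close> show ?thesis by (rule that)
qed

text \<open>
  The projection commutes with every \<open>B\<close> that leaves \<open>N\<close> invariant together with its adjoint, since
  then \<open>B\<close> also leaves the orthogonal complement invariant.
\<close>

lemma closed_subspace_projection:
  fixes N :: "'a::complex_hilbert_space set"
  assumes "closed N" and N: "complex_vector.subspace N"
  obtains q where "selfadjoint_idempotent q" "\<And>v. q v \<in> N" "\<And>v. v \<in> N \<Longrightarrow> q v = v"
    "\<And>B B'. is_adjoint B B' \<Longrightarrow> blinfun_apply B ` N \<subseteq> N \<Longrightarrow> blinfun_apply B' ` N \<subseteq> N
       \<Longrightarrow> q o\<^sub>L B = B o\<^sub>L q"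
proof -
  have "\<forall>x. \<exists>y. y \<in> N \<and> (\<forall>z\<in>N. cinner (x - y) z = 0)"
    by (rule allI, rule closed_subspace_nearest_point[OF assms]) (intro exI conjI ballI)
  from choice[OF this] obtain f where "\<forall>x. f x \<in> N \<and> (\<forall>z\<in>N. cinner (x - f x) z = 0)" ..
  then have f: "f x \<in> N" "z \<in> N \<Longrightarrow> cinner (x - f x) z = 0" for x z
    by auto
  have Nadd: "u + v \<in> N" if "u \<in> N" "v \<in> N" for u v
    using N that by (rule complex_vector.subspace_add)
  have Nsc: "c *\<^sub>C u \<in> N" if "u \<in> N" for u c
    using N that by (rule complex_vector.subspace_scale)
  have Ndiff: "u - v \<in> N" if "u \<in> N" "v \<in> N" for u v
    using N that by (rule complex_vector.subspace_diff)
  have uniq: "f x = y" if "y \<in> N" "\<And>z. z \<in> N \<Longrightarrow> cinner (x - y) z = 0" for x y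
  proof -
    have d: "f x - y \<in> N" by (intro Ndiff f that)
    have "cinner (f x - y) (f x - y) = cinner (x - y) (f x - y) - cinner (x - f x) (f x - y)"
      by (simp add: cinner.diff_left)
    then show ?thesis using f(2)[OF d] that(2)[OF d] cinner_self_eq_0[of "f x - y"] by simp
  qed
  have fN: "f x = x" if "x \<in> N" for x
    by (rule uniq[OF that]) (simp add: cinner.zero_left)
  have fadd: "f (x + y) = f x + f y" for x y
  proof (rule uniq)
    fix z assume "z \<in> N"
    have "x + y - (f x + f y) = (x - f x) + (y - f y)" by simp
    then show "cinner (x + y - (f x + f y)) z = 0"
      using \<open>z \<in> N\<close> f by (simp only: cinner_add_left) simp
  qed (intro Nadd f)
  have fsc: "f (c *\<^sub>C x) = c *\<^sub>C f x" for c x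
  proof (rule uniq)
    fix z assume "z \<in> N"
    then show "cinner (c *\<^sub>C x - c *\<^sub>C f x) z = 0"
      using f by (simp add: cinner_scaleC_left flip: complex_vector.scale_right_diff_distrib)
  qed (intro Nsc f)
  have fnorm: "norm (f x) \<le> norm x" for x
  proof (rule power2_le_imp_le)
    have "(norm (x - f x + f x))\<^sup>2 = (norm (x - f x))\<^sup>2 + (norm (f x))\<^sup>2"
      unfolding norm_add_square using f by simp
    then show "(norm (f x))\<^sup>2 \<le> (norm x)\<^sup>2" by simp
  qed simp
  have "bounded_linear f"
    by (rule bounded_linear_intro[where K = 1]) (simp_all add: fadd scaleR_scaleC fsc fnorm)
  then have ap: "blinfun_apply (Blinfun f) = f" by (rule bounded_linear_Blinfun_apply)
  have sa: "cinner (f x) y = cinner x (f y)" for x y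
  proof -
    have "cinner (f x) (y - f y) = cnj (cinner (y - f y) (f x))" by (rule cinner_commute)
    then have "cinner (f x) (y - f y) = 0" using f by simp
    then show ?thesis using f(2)[of "f y" x, OF f(1)] by (simp add: cinner.diff_left cinner.diff_right)
  qed
  show ?thesis
  proof (rule that[of "Blinfun f"])
    show "selfadjoint_idempotent (Blinfun f)"
      unfolding selfadjoint_idempotent_def bounded_ops_def is_adjoint_def
      by (auto simp: ap fsc sa fN f intro!: blinfun_eqI)
  next
    fix B B' :: "'a \<Rightarrow>\<^sub>L 'a"
    assume B: "is_adjoint B B'" "blinfun_apply B ` N \<subseteq> N" "blinfun_apply B' ` N \<subseteq> N"
    have "f (B x) = B (f x)" for x
    proof (rule uniq)
      show "B (f x) \<in> N" using B f by auto
      fix z assume "z \<in> N"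
      have "cinner (B x - B (f x)) z = cinner (x - f x) (B' z)"
        using B(1) by (simp add: is_adjointD flip: blinfun.diff_right)
      then show "cinner (B x - B (f x)) z = 0" using B \<open>z \<in> N\<close> f by auto
    qed
    then show "Blinfun f o\<^sub>L B = B o\<^sub>L Blinfun f"
      by (intro blinfun_eqI) (simp add: ap)
  qed (simp_all add: ap f fN)
qed

section \<open>The absolute value of a self-adjoint operator\<close>

text \<open>
  Iterating \<open>X \<mapsto> (R + X\<^sup>2) / 2\<close> from \<open>0\<close> converges to \<open>1 - \<surd>(1 - R)\<close> when \<open>\<parallel>R\<parallel> \<le> 1\<close>. The iterates are
  polynomials in \<open>R\<close> with nonnegative coefficients, hence dominated by the scalar iteration at \<open>R = 1\<close>.
\<close>

primrec sqrt_iter :: "('a::banach \<Rightarrow>\<^sub>L 'a) \<Rightarrow> nat \<Rightarrow> 'a \<Rightarrow>\<^sub>L 'a" where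
  "sqrt_iter A 0 = 0"
| "sqrt_iter A (Suc n) = (1 / 2) *\<^sub>R (A + (sqrt_iter A n o\<^sub>L sqrt_iter A n))"

primrec sqrt_majorant :: "nat \<Rightarrow> real" where
  "sqrt_majorant 0 = 0"
| "sqrt_majorant (Suc n) = (1 + (sqrt_majorant n)\<^sup>2) / 2"

lemma sqrt_majorant_bounds: "0 \<le> sqrt_majorant n \<and> sqrt_majorant n \<le> 1"
  by (induction n) (auto simp: power_le_one)

lemma sqrt_majorant_Suc: "sqrt_majorant n \<le> sqrt_majorant (Suc n)"
proof -
  have "0 \<le> (1 - sqrt_majorant n)\<^sup>2" by simp
  then show ?thesis by (simp add: power2_eq_square algebra_simps)
qed

lemma sqrt_iter_commute:
  "B o\<^sub>L A = A o\<^sub>L B \<Longrightarrow> B o\<^sub>L sqrt_iter A n = sqrt_iter A n o\<^sub>L B"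
proof (induction n)
  case (Suc n)
  have "B o\<^sub>L (sqrt_iter A n o\<^sub>L sqrt_iter A n) = (sqrt_iter A n o\<^sub>L sqrt_iter A n) o\<^sub>L B"
    using Suc by (metis blinfun_compose_assoc)
  with Suc.prems show ?case
    by (simp add: blinfun_compose.add_left blinfun_compose.add_right
        blinfun_compose.scaleR_left blinfun_compose.scaleR_right)
qed simp

lemma sqrt_iter_norm: "norm A \<le> 1 \<Longrightarrow> norm (sqrt_iter A n) \<le> sqrt_majorant n"
proof (induction n)
  case (Suc n)
  let ?X = "sqrt_iter A n"
  have "norm (A + (?X o\<^sub>L ?X)) \<le> norm A + norm ?X * norm ?X"
    by (meson add_left_mono norm_blinfun_compose norm_triangle_le)
  also have "\<dots> \<le> 1 + sqrt_majorant n * sqrt_majorant n"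
    using Suc sqrt_majorant_bounds by (intro add_mono mult_mono) auto
  finally show ?case by (simp add: power2_eq_square)
qed simp

text \<open>
  The increments of the operator iteration are dominated by those of the scalar iteration: both are
  half a difference of squares, and the factorisation \<open>Y\<^sup>2 - X\<^sup>2 = (Y + X) (Y - X)\<close> is available because
  the iterates commute.
\<close>

lemma sqrt_iter_step:
  assumes "norm A \<le> 1"
  shows "norm (sqrt_iter A (Suc n) - sqrt_iter A n) \<le> sqrt_majorant (Suc n) - sqrt_majorant n"
proof (induction n)
  case 0
  then show ?case using assms by simp
next
  case (Suc n)
  define X Y where "X = sqrt_iter A n" and "Y = sqrt_iter A (Suc n)"
  define x y where "x = sqrt_majorant n" and "y = sqrt_majorant (Suc n)"
  have "X o\<^sub>L A = A o\<^sub>L X"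
    unfolding X_def by (rule sqrt_iter_commute[symmetric]) simp
  then have "X o\<^sub>L Y = Y o\<^sub>L X"
    unfolding Y_def by (rule sqrt_iter_commute)
  then have YX: "(Y o\<^sub>L Y) - (X o\<^sub>L X) = (Y + X) o\<^sub>L (Y - X)"
    by (simp add: blinfun_compose.add_left blinfun_compose.diff_right)
  have Y': "Y = (1 / 2) *\<^sub>R (A + (X o\<^sub>L X))" by (simp add: X_def Y_def)
  have "sqrt_iter A (Suc (Suc n)) - Y = (1 / 2) *\<^sub>R (A + (Y o\<^sub>L Y)) - (1 / 2) *\<^sub>R (A + (X o\<^sub>L X))"
    unfolding Y'[symmetric] by (simp only: sqrt_iter.simps(2)[of A "Suc n"] Y_def)
  also have "\<dots> = (1 / 2) *\<^sub>R ((Y + X) o\<^sub>L (Y - X))"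
    unfolding scaleR_diff_right[symmetric] by (simp add: YX)
  finally have "norm (sqrt_iter A (Suc (Suc n)) - Y) = 1 / 2 * norm ((Y + X) o\<^sub>L (Y - X))"
    by simp
  also have "\<dots> \<le> 1 / 2 * ((y + x) * (y - x))"
  proof -
    have "norm Y \<le> y" "norm X \<le> x"
      unfolding X_def Y_def x_def y_def by (rule sqrt_iter_norm[OF assms])+
    then have "norm (Y + X) \<le> y + x" by (rule norm_triangle_mono)
    moreover have "norm (Y - X) \<le> y - x"
      using Suc.IH by (simp only: X_def Y_def x_def y_def)
    ultimately have "norm (Y + X) * norm (Y - X) \<le> (y + x) * (y - x)"
      by (intro mult_mono) (auto intro: order_trans[OF norm_ge_zero])
    then show ?thesis
      using norm_blinfun_compose[of "Y + X" "Y - X"] by simp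
  qed
  also have "\<dots> = (1 + y\<^sup>2) / 2 - (1 + x\<^sup>2) / 2"
    by (simp add: power2_eq_square field_simps)
  also have "\<dots> = sqrt_majorant (Suc (Suc n)) - y"
    by (simp only: x_def y_def sqrt_majorant.simps(2)[of "Suc n"] sqrt_majorant.simps(2)[of n])
  finally show ?case by (simp only: Y_def y_def)
qed

lemma sqrt_iter_convergent:
  assumes "norm A \<le> 1"
  shows "convergent (sqrt_iter A)"
proof -
  let ?d = "\<lambda>n. sqrt_majorant (Suc n) - sqrt_majorant n"
  have "convergent sqrt_majorant"
  proof (rule Bseq_mono_convergent)
    show "Bseq sqrt_majorant"
      by (rule BseqI'[of _ 1]) (simp add: sqrt_majorant_bounds)
    show "\<forall>m n. m \<le> n \<longrightarrow> sqrt_majorant m \<le> sqrt_majorant n"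
      using lift_Suc_mono_le[of sqrt_majorant, OF sqrt_majorant_Suc] by blast
  qed
  then obtain l where "sqrt_majorant \<longlonglongrightarrow> l" by (auto simp: convergent_def)
  then have "summable ?d"
    using telescope_summable by blast
  then have "summable (\<lambda>n. sqrt_iter A (Suc n) - sqrt_iter A n)"
    by (rule summable_comparison_test'[of _ 0]) (rule sqrt_iter_step[OF assms])
  then have "convergent (\<lambda>n. \<Sum>i<n. sqrt_iter A (Suc i) - sqrt_iter A i)"
    by (simp only: summable_iff_convergent)
  then show ?thesis
    by (simp only: sum_lessThan_telescope) simp
qed

text \<open>
  Positivity of \<open>S\<close> comes for free from \<open>S = 1 - X\<close> with \<open>\<parallel>X\<parallel> \<le> 1\<close>, and \<open>S\<close> commutes with the
  commutant of \<open>A\<close> as a norm limit of polynomials in \<open>A\<^sup>2\<close>.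
\<close>

lemma absolute_value_exists:
  fixes A :: "'a::complex_hilbert_space \<Rightarrow>\<^sub>L 'a"
  assumes "is_adjoint A A" "norm A \<le> 1"
  obtains S where "S o\<^sub>L S = A o\<^sub>L A" "\<And>v. 0 \<le> Re (cinner (S v) v)"
    "\<And>B. B o\<^sub>L A = A o\<^sub>L B \<Longrightarrow> B o\<^sub>L S = S o\<^sub>L B"
proof -
  define R where "R = id_blinfun - (A o\<^sub>L A)"
  have "norm R \<le> 1"
  proof (rule norm_blinfun_bound)
    fix v :: 'a
    have "norm (A (A v)) \<le> norm A * norm (A v)" by (rule norm_blinfun)
    also have "\<dots> \<le> 1 * norm (A v)" using assms by (intro mult_right_mono) auto
    finally have "(norm (A (A v)))\<^sup>2 \<le> (norm (A v))\<^sup>2" by (intro power_mono) auto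
    moreover have "Re (cinner v (A (A v))) = (norm (A v))\<^sup>2"
      using assms by (metis is_adjointD norm_square)
    moreover have "(norm (v + - A (A v)))\<^sup>2
        = (norm v)\<^sup>2 - 2 * Re (cinner v (A (A v))) + (norm (A (A v)))\<^sup>2"
      unfolding norm_add_square by (simp add: cinner.minus_right)
    ultimately have "(norm (v + - A (A v)))\<^sup>2 \<le> (norm v)\<^sup>2"
      using zero_le_power2[of "norm (A v)"] by linarith
    then have "norm (v + - A (A v)) \<le> norm v" by (rule power2_le_imp_le) simp
    then show "norm (R v) \<le> 1 * norm v" by (simp add: R_def blinfun.diff_left)
  qed simp
  then obtain X where X: "sqrt_iter R \<longlonglongrightarrow> X"
    using sqrt_iter_convergent convergent_def by blast
  have "(\<lambda>n. sqrt_iter R (Suc n)) \<longlonglongrightarrow> (1 / 2) *\<^sub>R (R + (X o\<^sub>L X))"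
    unfolding sqrt_iter.simps by (intro tendsto_intros blinfun_compose.tendsto X)
  then have fixpoint: "X = (1 / 2) *\<^sub>R (R + (X o\<^sub>L X))"
    using LIMSEQ_unique LIMSEQ_Suc[OF X] by blast
  have "norm X \<le> 1"
    by (rule LIMSEQ_le_const2[OF tendsto_norm[OF X]])
       (use sqrt_iter_norm[OF \<open>norm R \<le> 1\<close>] sqrt_majorant_bounds order_trans in blast)
  show ?thesis
  proof (rule that[of "id_blinfun - X"])
    have "2 *\<^sub>R X = R + (X o\<^sub>L X)" by (subst fixpoint) simp
    then have "X + X = R + (X o\<^sub>L X)" by (simp add: scaleR_2)
    then have "X o\<^sub>L X = (X + X) - (id_blinfun - (A o\<^sub>L A))" by (simp add: R_def algebra_simps)
    then show "(id_blinfun - X) o\<^sub>L (id_blinfun - X) = A o\<^sub>L A"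
      by (simp add: blinfun_compose.diff_left blinfun_compose.diff_right blinfun_compose_id)
  next
    fix v :: 'a
    have "Re (cinner (X v) v) \<le> norm (X v) * norm v"
      using Cauchy_Schwarz_cinner complex_Re_le_cmod order_trans by blast
    also have "\<dots> \<le> (1 * norm v) * norm v"
      using order_trans[OF norm_blinfun mult_right_mono[OF \<open>norm X \<le> 1\<close> norm_ge_zero]]
      by (intro mult_right_mono) auto
    finally show "0 \<le> Re (cinner ((id_blinfun - X) v) v)"
      by (simp add: blinfun.diff_left cinner.diff_left norm_square[symmetric] power2_eq_square)
  next
    fix B assume "B o\<^sub>L A = A o\<^sub>L B"
    then have "B o\<^sub>L (A o\<^sub>L A) = (A o\<^sub>L A) o\<^sub>L B"
      by (metis blinfun_compose_assoc)
    then have "B o\<^sub>L R = R o\<^sub>L B"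
      by (simp add: R_def blinfun_compose.diff_left blinfun_compose.diff_right blinfun_compose_id)

    then have "(\<lambda>n. B o\<^sub>L sqrt_iter R n) = (\<lambda>n. sqrt_iter R n o\<^sub>L B)"
      by (simp add: sqrt_iter_commute)
    moreover have "(\<lambda>n. B o\<^sub>L sqrt_iter R n) \<longlonglongrightarrow> (B o\<^sub>L X)" "(\<lambda>n. sqrt_iter R n o\<^sub>L B) \<longlonglongrightarrow> (X o\<^sub>L B)"
      by (intro blinfun_compose.tendsto X tendsto_const)+
    ultimately have "B o\<^sub>L X = X o\<^sub>L B" using LIMSEQ_unique by metis
    then show "B o\<^sub>L (id_blinfun - X) = (id_blinfun - X) o\<^sub>L B"
      by (simp add: blinfun_compose.diff_left blinfun_compose.diff_right blinfun_compose_id)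
  qed
qed

section \<open>Projections in a masa\<close>

lemma masa_bounded: "masa D \<Longrightarrow> a \<in> D \<Longrightarrow> a \<in> bounded_ops"
  unfolding masa_def abelian_selfadjoint_subalgebra_def by blast

lemma masa_0: "masa D \<Longrightarrow> 0 \<in> D"
  unfolding masa_def abelian_selfadjoint_subalgebra_def by blast

lemma masa_add: "masa D \<Longrightarrow> a \<in> D \<Longrightarrow> b \<in> D \<Longrightarrow> a + b \<in> D"
  unfolding masa_def abelian_selfadjoint_subalgebra_def by blast

lemma masa_op_scaleC: "masa D \<Longrightarrow> a \<in> D \<Longrightarrow> op_scaleC c a \<in> D"
  unfolding masa_def abelian_selfadjoint_subalgebra_def by blast

lemma masa_compose: "masa D \<Longrightarrow> a \<in> D \<Longrightarrow> b \<in> D \<Longrightarrow> a o\<^sub>L b \<in> D"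
  unfolding masa_def abelian_selfadjoint_subalgebra_def by blast

lemma masa_commute: "masa D \<Longrightarrow> a \<in> D \<Longrightarrow> b \<in> D \<Longrightarrow> a o\<^sub>L b = b o\<^sub>L a"
  unfolding masa_def abelian_selfadjoint_subalgebra_def by blast

lemma masa_commute_apply: "masa D \<Longrightarrow> a \<in> D \<Longrightarrow> b \<in> D \<Longrightarrow> a (b v) = b (a v)"
  by (metis masa_commute blinfun_apply_blinfun_compose)

lemma masa_adjoint:
  assumes "masa D" "a \<in> D"
  obtains b where "b \<in> D" "is_adjoint a b"
  using assms unfolding masa_def abelian_selfadjoint_subalgebra_def by blast

lemma masa_maximal:
  "masa D \<Longrightarrow> abelian_selfadjoint_subalgebra E \<Longrightarrow> D \<subseteq> E \<Longrightarrow> E = D"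
  unfolding masa_def by blast

lemma masa_diff:
  assumes "masa D" "a \<in> D" "b \<in> D"
  shows "a - b \<in> D"
proof -
  have "a + op_scaleC (-1) b \<in> D"
    using assms by (intro masa_add masa_op_scaleC)
  also have "a + op_scaleC (-1) b = a - b"
    by (rule blinfun_eqI) (simp add: op_scaleC_apply blinfun.bilinear_simps)
  finally show ?thesis .
qed

text \<open>
  Adjoining \<open>t\<close> to \<open>D\<close> gives the operators \<open>a + b t + c t\<close> with \<open>a, b \<in> D\<close> and a scalar \<open>c\<close>; since \<open>t\<close> is
  idempotent these already form an abelian self-adjoint algebra, which maximality identifies with \<open>D\<close>.
  The separate scalar term makes the argument work before it is known that \<open>1 \<in> D\<close>, and the case
  \<open>t = 1\<close> then yields that fact.
\<close>

lemma masa_contains_commuting_projection: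
  fixes D :: "('a::complex_hilbert_space \<Rightarrow>\<^sub>L 'a) set"
  assumes D: "masa D" and t: "selfadjoint_idempotent t"
    and comm: "\<And>b. b \<in> D \<Longrightarrow> t o\<^sub>L b = b o\<^sub>L t"
  shows "t \<in> D"
proof -
  define F where "F a b c = a + (b o\<^sub>L t) + op_scaleC c t" for a b c
  define E where "E = {F a b c | a b c. a \<in> D \<and> b \<in> D}"
  have tB: "t \<in> bounded_ops" and tadj: "\<And>x y. cinner (t x) y = cinner x (t y)"
    and tt: "\<And>v. t (t v) = t v"
    using t by (auto simp: selfadjoint_idempotent_def selfadjoint_idempotent_apply is_adjoint_def)
  have tb: "t (b v) = b (t v)" if "b \<in> D" for b v
    using comm[OF that] by (metis blinfun_apply_blinfun_compose)
  have EI: "F a b c \<in> E" if "a \<in> D" "b \<in> D" for a b c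
    using that by (auto simp: E_def)
  have prod: "F a b c o\<^sub>L F a' b' c' = F (a o\<^sub>L a')
      ((a o\<^sub>L b') + (b o\<^sub>L a') + (b o\<^sub>L b') + op_scaleC c' a + op_scaleC c' b + op_scaleC c b' + op_scaleC c a') (c * c')"
    if "a \<in> D" "b \<in> D" "a' \<in> D" "b' \<in> D" for a b c a' b' c'
    unfolding F_def using that masa_bounded[OF D]
    by (intro blinfun_eqI)
       (simp add: blinfun.add_left blinfun.add_right op_scaleC_apply bounded_ops_scaleC scaleC_add_right
          scaleC_scaleC tb tt bounded_ops_scaleC[OF tB] mult.commute)
  have "abelian_selfadjoint_subalgebra E"
    unfolding abelian_selfadjoint_subalgebra_def
  proof (intro conjI ballI allI)
    show "E \<subseteq> bounded_ops"
      unfolding E_def F_def using masa_bounded[OF D] tB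
      by (auto intro!: bounded_ops_add bounded_ops_compose bounded_ops_op_scaleC)
    have "F 0 0 0 = 0"
      unfolding F_def by (rule blinfun_eqI) (simp add: blinfun.add_left op_scaleC_apply)
    then show "0 \<in> E" using EI[OF masa_0[OF D] masa_0[OF D]] by metis
  next
    fix A B assume "A \<in> E" "B \<in> E"
    then obtain a b c a' b' c' where A: "A = F a b c" "a \<in> D" "b \<in> D"
      and B: "B = F a' b' c'" "a' \<in> D" "b' \<in> D"
      unfolding E_def by blast
    have "A + B = F (a + a') (b + b') (c + c')"
      unfolding A B F_def by (rule blinfun_eqI)
        (simp add: blinfun.add_left op_scaleC_apply scaleC_add_left)
    then show "A + B \<in> E" using A B masa_add[OF D] by (auto intro!: EI)
    show "A o\<^sub>L B \<in> E"
      unfolding A B prod[OF A(2,3) B(2,3)] using A B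
      by (intro EI masa_add[OF D] masa_compose[OF D] masa_op_scaleC[OF D])
    show "A o\<^sub>L B = B o\<^sub>L A"
      unfolding A B prod[OF A(2,3) B(2,3)] prod[OF B(2,3) A(2,3)]
      using A(2,3) B(2,3) by (simp add: masa_commute[OF D] add_ac mult.commute)
  next
    fix e A assume "A \<in> E"
    then obtain a b c where A: "A = F a b c" "a \<in> D" "b \<in> D"
      unfolding E_def by blast
    have "op_scaleC e A = F (op_scaleC e a) (op_scaleC e b) (e * c)"
      unfolding A F_def by (rule blinfun_eqI)
        (simp add: blinfun.add_left op_scaleC_apply scaleC_add_right scaleC_scaleC)
    then show "op_scaleC e A \<in> E" using A masa_op_scaleC[OF D] by (auto intro!: EI)
    obtain a' b' where a': "a' \<in> D" "is_adjoint a a'" and b': "b' \<in> D" "is_adjoint b b'"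
      using masa_adjoint[OF D] A by metis
    have "is_adjoint A (F a' b' (cnj c))"
      unfolding is_adjoint_def A F_def
      by (simp add: blinfun.add_left op_scaleC_apply cinner_add_left cinner_add_right
          cinner_scaleC_left cinner_scaleC_right tadj is_adjointD[OF a'(2)] is_adjointD[OF b'(2)] tb[OF b'(1)])
    then show "\<exists>B\<in>E. is_adjoint A B" using EI a' b' by blast
  qed
  moreover have "D \<subseteq> E"
  proof
    fix a assume "a \<in> D"
    have "F a 0 0 = a"
      unfolding F_def by (rule blinfun_eqI) (simp add: blinfun.add_left op_scaleC_apply)
    then show "a \<in> E" using EI[OF \<open>a \<in> D\<close> masa_0[OF D]] by metis
  qed
  ultimately have "E = D" by (rule masa_maximal[OF D])
  moreover have "F 0 0 1 = t"
    unfolding F_def by (rule blinfun_eqI) (simp add: blinfun.add_left op_scaleC_apply scaleC_one)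
  ultimately show ?thesis using EI[OF masa_0[OF D] masa_0[OF D]] by metis
qed

lemma masa_id: "masa D \<Longrightarrow> id_blinfun \<in> D"
  by (erule masa_contains_commuting_projection)
     (simp_all add: selfadjoint_idempotent_def bounded_ops_def is_adjoint_def blinfun_compose_id)

definition masa_projection :: "('a::complex_hilbert_space \<Rightarrow>\<^sub>L 'a) set \<Rightarrow> ('a \<Rightarrow>\<^sub>L 'a) \<Rightarrow> bool" where
  "masa_projection D p \<longleftrightarrow> p \<in> D \<and> selfadjoint_idempotent p"

lemma masa_projection_apply: "masa_projection D p \<Longrightarrow> p (p v) = p v"
  by (simp add: masa_projection_def selfadjoint_idempotent_apply)

lemma masa_projection_diff:
  assumes D: "masa D" and p: "masa_projection D p" and q: "masa_projection D q" and le: "p o\<^sub>L q = q"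
  shows "masa_projection D (p - q)"
proof -
  have "p \<in> D" "q \<in> D" using p q by (auto simp: masa_projection_def)
  then have le': "q o\<^sub>L p = q" using masa_commute[OF D, of p q] le by simp
  have "p o\<^sub>L p = p" "q o\<^sub>L q = q"
    using p q by (auto simp: masa_projection_def selfadjoint_idempotent_def)
  then have "(p - q) o\<^sub>L (p - q) = p - q"
    using le le' by (simp add: blinfun_compose.diff_left blinfun_compose.diff_right)
  moreover have "p - q \<in> D" using D \<open>p \<in> D\<close> \<open>q \<in> D\<close> by (rule masa_diff)
  moreover have "is_adjoint (p - q) (p - q)"
    using p q by (simp add: masa_projection_def selfadjoint_idempotent_def is_adjoint_def
        blinfun.diff_left cinner.diff_left cinner.diff_right)
  ultimately show ?thesis
    using masa_bounded[OF D] by (simp add: masa_projection_def selfadjoint_idempotent_def)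
qed

lemma masa_invariant_subspace_projection:
  assumes D: "masa D" and N: "closed N" "complex_vector.subspace N"
    and inv: "\<And>b v. b \<in> D \<Longrightarrow> v \<in> N \<Longrightarrow> b v \<in> N"
  obtains q where "masa_projection D q" "\<And>v. q v \<in> N" "\<And>v. v \<in> N \<Longrightarrow> q v = v"
proof -
  obtain q where q: "selfadjoint_idempotent q" "\<And>v. q v \<in> N" "\<And>v. v \<in> N \<Longrightarrow> q v = v"
    "\<And>B B'. is_adjoint B B' \<Longrightarrow> blinfun_apply B ` N \<subseteq> N \<Longrightarrow> blinfun_apply B' ` N \<subseteq> N
       \<Longrightarrow> q o\<^sub>L B = B o\<^sub>L q"
    using closed_subspace_projection[OF N] by blast
  have "q \<in> D"
  proof (rule masa_contains_commuting_projection[OF D q(1)])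
    fix b assume "b \<in> D"
    then obtain b' where "b' \<in> D" "is_adjoint b b'" using masa_adjoint[OF D] by blast
    then show "q o\<^sub>L b = b o\<^sub>L q" using inv \<open>b \<in> D\<close> by (intro q(4)) auto
  qed
  with q show ?thesis by (intro that) (auto simp: masa_projection_def)
qed

definition minimal_projection :: "('a::complex_hilbert_space \<Rightarrow>\<^sub>L 'a) set \<Rightarrow> ('a \<Rightarrow>\<^sub>L 'a) \<Rightarrow> bool" where
  "minimal_projection D p \<longleftrightarrow> masa_projection D p \<and>
     (\<forall>q. masa_projection D q \<longrightarrow> p o\<^sub>L q = q \<longrightarrow> q = 0 \<or> q = p)"

lemma minimal_projection_invariant_subspace:
  assumes D: "masa D" and p: "minimal_projection D p" and N: "closed N" "complex_vector.subspace N"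
    and inv: "\<And>b v. b \<in> D \<Longrightarrow> v \<in> N \<Longrightarrow> b v \<in> N" and le: "\<And>v. v \<in> N \<Longrightarrow> p v = v"
  shows "N = {0} \<or> N = {v. p v = v}"
proof -
  obtain q where q: "masa_projection D q" "\<And>v. q v \<in> N" "\<And>v. v \<in> N \<Longrightarrow> q v = v"
    using masa_invariant_subspace_projection[OF D N inv] by blast
  have "p o\<^sub>L q = q"
    by (rule blinfun_eqI) (simp add: le q)
  with p q(1) have "q = 0 \<or> q = p" by (simp add: minimal_projection_def)
  then show ?thesis
  proof
    assume "q = 0"
    then have "N \<subseteq> {0}" using q(3) by force
    then show ?thesis using N complex_vector.subspace_0 by blast
  next
    assume "q = p"
    then have "v \<in> N" if "p v = v" for v using q(2)[of v] that by simp
    then show ?thesis using le by blast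
  qed
qed

text \<open>
  With \<open>S\<close> the absolute value of \<open>A\<close>, the kernel of \<open>S - A\<close> in \<open>p H\<close> is \<open>D\<close>-invariant, so by minimality it
  is all of \<open>p H\<close>, where then \<open>A = S \<ge> 0\<close>, or it is \<open>0\<close>. In the second case it still contains the
  range of \<open>S + A\<close> on \<open>p H\<close>, so \<open>A = - S \<le> 0\<close> there.
\<close>

lemma minimal_projection_sign:
  assumes D: "masa D" and p: "minimal_projection D p" and a: "a \<in> D" "is_adjoint a a"
  shows "(\<forall>v. p v = v \<longrightarrow> 0 \<le> Re (cinner (a v) v)) \<or> (\<forall>v. p v = v \<longrightarrow> Re (cinner (a v) v) \<le> 0)"
proof -
  \<comment> \<open>Rescaling to a contraction does not change the sign.\<close>
  define s where "s = 1 / (norm a + 1)"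
  have s: "s > 0" by (simp add: s_def add_nonneg_pos)
  define A where "A = s *\<^sub>R a"
  have "norm A \<le> 1" by (simp add: A_def s_def divide_le_eq add_nonneg_pos)
  moreover have "is_adjoint A A"
    using a(2) by (simp add: A_def is_adjoint_def blinfun.scaleR_left cinner.scaleR_left cinner.scaleR_right)
  ultimately obtain S where S: "S o\<^sub>L S = A o\<^sub>L A" "\<And>v. 0 \<le> Re (cinner (S v) v)"
    "\<And>B. B o\<^sub>L A = A o\<^sub>L B \<Longrightarrow> B o\<^sub>L S = S o\<^sub>L B"
    using absolute_value_exists by blast
  have bA: "b o\<^sub>L A = A o\<^sub>L b" if "b \<in> D" for b
    using masa_commute[OF D that a(1)]
    by (simp add: A_def blinfun_compose.scaleR_left blinfun_compose.scaleR_right)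
  have AA: "S (S v) = A (A v)" for v using S(1) by (metis blinfun_apply_blinfun_compose)
  have bA': "b (A v) = A (b v)" and bS': "b (S v) = S (b v)" if "b \<in> D" for b v
    using bA[OF that] S(3)[OF bA[OF that]] by (metis blinfun_apply_blinfun_compose)+
  have SA: "S (A v) = A (S v)" for v
    using S(3)[of A] by (metis blinfun_apply_blinfun_compose)
  have pD: "p \<in> D" using p by (simp add: minimal_projection_def masa_projection_def)
  \<comment> \<open>Complex linearity of \<open>S\<close> is an instance of its commuting with \<open>D\<close>, which contains the scalars.\<close>
  have scal: "c *\<^sub>C S v = S (c *\<^sub>C v)" "c *\<^sub>C A v = A (c *\<^sub>C v)" "c *\<^sub>C p v = p (c *\<^sub>C v)" for c v
    using bS'[OF masa_op_scaleC[OF D masa_id[OF D], of c], of v]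
      bA'[OF masa_op_scaleC[OF D masa_id[OF D], of c], of v] bounded_ops_scaleC[OF masa_bounded[OF D pD]]
    by (simp_all add: op_scaleC_apply)
  define N where "N = {v. p v = v \<and> S v = A v}"
  have "N = {0} \<or> N = {v. p v = v}"
  proof (rule minimal_projection_invariant_subspace[OF D p])
    show "closed N"
      unfolding N_def
      by (intro closed_Collect_conj closed_Collect_eq) (intro continuous_intros)+
    show "complex_vector.subspace N"
      unfolding complex_vector.subspace_def N_def
      by (auto simp: blinfun.add_right scal[symmetric])
    show "b v \<in> N" if "b \<in> D" "v \<in> N" for b v
      using that by (simp add: N_def bA'[symmetric] bS'[symmetric] masa_commute_apply[OF D pD])
  qed (simp add: N_def)
  then show ?thesis
  proof
    assume N: "N = {v. p v = v}"
    have "0 \<le> Re (cinner (a v) v)" if "p v = v" for v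
    proof -
      have "S v = A v" using that N by (auto simp: N_def)
      then have "0 \<le> s * Re (cinner (a v) v)"
        using S(2)[of v] by (simp add: A_def blinfun.scaleR_left cinner.scaleR_left)
      then show ?thesis using s by (simp add: zero_le_mult_iff)
    qed
    then show ?thesis by blast
  next
    assume N: "N = {0}"
    have "Re (cinner (a v) v) \<le> 0" if "p v = v" for v
    proof -
      have "S v + A v \<in> N"
        using that by (simp add: N_def blinfun.add_right bA'[OF pD] bS'[OF pD] AA SA)
      then have "A v = - S v" using N by (simp add: eq_neg_iff_add_eq_0 add.commute)
      then have "s * Re (cinner (a v) v) = - Re (cinner (S v) v)"
        by (metis A_def blinfun.scaleR_left cinner.minus_left cinner.scaleR_left scaleR_complex.simps(1) uminus_complex.simps(1))
      then have "s * Re (cinner (a v) v) \<le> 0" using S(2)[of v] by simp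
      then show ?thesis using s by (simp add: mult_le_0_iff)
    qed
    then show ?thesis by blast
  qed
qed

text \<open>
  If the quadratic form of \<open>a\<close> took two different values at unit vectors of \<open>p H\<close>, then \<open>a - m p\<close> would
  have no sign for \<open>m\<close> strictly between them. So the form of \<open>B = a - t\<close> vanishes on \<open>p H\<close>, and
  evaluating it at \<open>u + B u\<close> gives \<open>2 \<parallel>B u\<parallel>\<^sup>2 = 0\<close>.
\<close>

lemma minimal_projection_selfadjoint_scalar:
  assumes D: "masa D" and p: "minimal_projection D p" and a: "a \<in> D" "is_adjoint a a"
    and u: "p u = u" "norm u = 1" 
  shows "a u = complex_of_real (Re (cinner (a u) u)) *\<^sub>C u"
proof -
  define t where "t = Re (cinner (a u) u)"
  have pD: "p \<in> D" and padj: "is_adjoint p p"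
    using p by (auto simp: minimal_projection_def masa_projection_def selfadjoint_idempotent_def)
  have form: "Re (cinner (a v) v) = t * (norm v)\<^sup>2" if v: "p v = v" for v
  proof (cases "v = 0")
    case False
    define r where "r = Re (cinner (a v) v) / (norm v)\<^sup>2"
    \<comment> \<open>The midpoint of the two values separates them unless they agree.\<close>
    define m where "m = (t + r) / 2"
    define b where "b = a - op_scaleC (complex_of_real m) p"
    have "b \<in> D" unfolding b_def by (intro masa_diff[OF D] masa_op_scaleC[OF D] a pD)
    moreover have "is_adjoint b b"
      using a(2) padj by (simp add: b_def is_adjoint_def blinfun.diff_left op_scaleC_apply
          cinner.diff_left cinner.diff_right cinner_scaleC_left cinner_scaleC_right)
    moreover have bw: "Re (cinner (b w) w) = Re (cinner (a w) w) - m * (norm w)\<^sup>2" if "p w = w" for w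
      using that by (simp add: b_def blinfun.diff_left op_scaleC_apply cinner.diff_left
          cinner_scaleC_left cinner_self)
    have "Re (cinner (b u) u) = (t - r) / 2"
      unfolding bw[OF u(1)] using u(2) by (simp add: t_def m_def field_simps)
    moreover have "Re (cinner (b v) v) = (r - t) / 2 * (norm v)\<^sup>2"
      unfolding bw[OF v] using False by (simp add: r_def m_def field_simps)
    ultimately have "0 \<le> (t - r) / 2 \<and> 0 \<le> (r - t) / 2 * (norm v)\<^sup>2
        \<or> (t - r) / 2 \<le> 0 \<and> (r - t) / 2 * (norm v)\<^sup>2 \<le> 0"
      using minimal_projection_sign[OF D p, of b] u v by metis
    then have "r = t" using False by (auto simp: zero_le_mult_iff mult_le_0_iff)
    then show ?thesis using False by (simp add: r_def field_simps)
  qed (simp add: cinner.zero_right)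
  define B where "B v = a v - complex_of_real t *\<^sub>C v" for v
  have B0: "Re (cinner (B v) v) = 0" if "p v = v" for v
    using form[OF that] by (simp add: B_def cinner.diff_left cinner_scaleC_left cinner_self)
  have pB: "p (B v) = B v" if "p v = v" for v
    using that masa_commute_apply[OF D pD a(1), of v] bounded_ops_scaleC[OF masa_bounded[OF D pD]]
    by (simp add: B_def blinfun.diff_right)
  have Badd: "B (v + w) = B v + B w" for v w
    by (simp add: B_def blinfun.add_right scaleC_add_right)
  have Badj: "cinner (B v) w = cinner v (B w)" for v w
    using a(2) by (simp add: B_def is_adjoint_def cinner.diff_left cinner.diff_right
        cinner_scaleC_left cinner_scaleC_right)
  have "0 = Re (cinner (B (u + B u)) (u + B u))"
    using B0[of "u + B u"] pB[OF u(1)] u(1) by (simp add: blinfun.add_right)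
  also have "\<dots> = Re (cinner (B u) u) + Re (cinner (B u) (B u)) + Re (cinner (B (B u)) u) + Re (cinner (B (B u)) (B u))"
    by (simp add: Badd cinner_add_left cinner_add_right)
  also have "\<dots> = 2 * (norm (B u))\<^sup>2"
    using B0[OF u(1)] B0[OF pB[OF u(1)]] Badj[of "B u" u] by (simp add: norm_square)
  finally have "B u = 0" by simp
  then show ?thesis by (simp add: B_def t_def)
qed

text \<open>
  Every element of \<open>D\<close> is a combination of two self-adjoint ones and therefore acts on a unit vector
  \<open>u\<close> of \<open>p H\<close> by a scalar. So the line through \<open>u\<close> is \<open>D\<close>-invariant and must be all of \<open>p H\<close>.
\<close>

lemma minimal_projection_rank_one:
  assumes D: "masa D" and p: "minimal_projection D p"
  obtains u where "range p \<subseteq> cspan {u}"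
proof (cases "p = 0")
  case True
  then show ?thesis using that[of 0] by (auto intro: complex_vector.span_zero)
next
  case False
  then obtain w where w: "p w \<noteq> 0" by (metis blinfun_eqI zero_blinfun.rep_eq)
  define u where "u = (1 / norm (p w)) *\<^sub>R p w"
  have pp: "p (p v) = p v" for v
    using p masa_projection_apply by (auto simp: minimal_projection_def)
  have pD: "p \<in> D" using p by (simp add: minimal_projection_def masa_projection_def)
  have u: "p u = u" "norm u = 1" using w by (auto simp: u_def blinfun.scaleR_right pp)
  have scalar: "\<exists>c. a u = c *\<^sub>C u" if a: "a \<in> D" for a
  proof -
    obtain a' where a': "a' \<in> D" "is_adjoint a a'" using masa_adjoint[OF D a] by blast
    define h k where "h = a + a'" and "k = op_scaleC \<i> (a - a')"
    have "h \<in> D" "k \<in> D"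
      unfolding h_def k_def by (intro masa_add[OF D] masa_op_scaleC[OF D] masa_diff[OF D] a a')+
    moreover have "is_adjoint h h" "is_adjoint k k"
      using a'(2) is_adjoint_sym[OF a'(2)]
      by (auto simp: h_def k_def is_adjoint_def blinfun.add_left blinfun.diff_left op_scaleC_apply
          cinner_add_left cinner_add_right cinner.diff_left cinner.diff_right
          cinner_scaleC_left cinner_scaleC_right algebra_simps)
    ultimately obtain c d where "h u = c *\<^sub>C u" "k u = d *\<^sub>C u"
      using minimal_projection_selfadjoint_scalar[OF D p _ _ u] by blast
    moreover have "a u = (1 / 2) *\<^sub>C (h u - \<i> *\<^sub>C k u)"
    proof -
      have "h u - \<i> *\<^sub>C k u = 2 *\<^sub>R a u"
        by (simp add: h_def k_def blinfun.add_left blinfun.diff_left op_scaleC_apply scaleC_scaleC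
            complex_vector.scale_right_diff_distrib scaleR_2 scaleC_one)
      then show ?thesis by (simp add: scaleR_scaleC scaleC_scaleC scaleC_one)
    qed
    ultimately show ?thesis
      by (metis complex_vector.scale_left_diff_distrib scaleC_scaleC)
  qed
  define N where "N = {v. v = cinner v u *\<^sub>C u}"
  have uN: "c *\<^sub>C u \<in> N" for c
    using u(2) by (simp add: N_def cinner_scaleC_left cinner_self)
  have N: "N = {v. \<exists>c. v = c *\<^sub>C u}"
    using uN by (auto simp: N_def)
  have "N = {0} \<or> N = {v. p v = v}"
  proof (rule minimal_projection_invariant_subspace[OF D p])
    show "closed N"
      unfolding N_def rank_one_apply[symmetric]
      by (intro closed_Collect_eq continuous_intros)
    show "complex_vector.subspace N"
      unfolding complex_vector.subspace_def N mem_Collect_eq[of 0] mem_Collect_eq[of "_ + _"] mem_Collect_eq[of "_ *\<^sub>C _"]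
    proof (intro conjI ballI allI)
      show "\<exists>c. 0 = c *\<^sub>C u" by (intro exI[of _ 0]) simp
      show "\<exists>c. v + w = c *\<^sub>C u" if "v \<in> {v. \<exists>c. v = c *\<^sub>C u}" "w \<in> {v. \<exists>c. v = c *\<^sub>C u}" for v w
        using that by (auto simp flip: scaleC_add_left)
      show "\<exists>c. e *\<^sub>C v = c *\<^sub>C u" if "v \<in> {v. \<exists>c. v = c *\<^sub>C u}" for e v
        using that by (auto simp: scaleC_scaleC)
    qed
    show "b v \<in> N" if "b \<in> D" "v \<in> N" for b v
      using that scalar[of b] masa_bounded[OF D that(1)] unfolding N
      by (auto simp: bounded_ops_scaleC scaleC_scaleC)
    show "p v = v" if "v \<in> N" for v
      using that masa_bounded[OF D pD] u(1) unfolding N by (auto simp: bounded_ops_scaleC)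
  qed
  moreover have "u \<in> N" "u \<noteq> 0" using uN[of 1] u(2) by (auto simp: scaleC_one)
  ultimately have "N = {v. p v = v}" by blast
  then have "p v \<in> N" for v using pp by auto
  then have "range p \<subseteq> cspan {u}"
    unfolding N by (auto simp: complex_vector.span_singleton)
  then show ?thesis by (rule that)
qed

definition infinite_rank :: "('a::complex_hilbert_space \<Rightarrow>\<^sub>L 'a) \<Rightarrow> bool" where
  "infinite_rank p \<longleftrightarrow> \<not> (\<exists>B. finite B \<and> range p \<subseteq> cspan B)"

text \<open>
  A proper subprojection \<open>q\<close> exists because \<open>p\<close> is not minimal; of \<open>q\<close> and \<open>p - q\<close> one has infinite rank.
\<close>

lemma infinite_rank_split:
  assumes D: "masa D" and p: "masa_projection D p" "infinite_rank p"
  shows "\<exists>q. masa_projection D q \<and> infinite_rank q \<and> p o\<^sub>L q = q \<and> q \<noteq> p"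
proof -
  have "\<not> minimal_projection D p"
  proof
    assume "minimal_projection D p"
    then obtain u where "range p \<subseteq> cspan {u}" using minimal_projection_rank_one[OF D] by blast
    with p(2) show False unfolding infinite_rank_def by blast
  qed
  then obtain q where q: "masa_projection D q" "p o\<^sub>L q = q" "q \<noteq> 0" "q \<noteq> p"
    using p(1) by (auto simp: minimal_projection_def)
  show ?thesis
  proof (cases "infinite_rank q")
    case True
    with q show ?thesis by blast
  next
    case False
    then obtain B where B: "finite B" "range q \<subseteq> cspan B" by (auto simp: infinite_rank_def)
    have "infinite_rank (p - q)"
      unfolding infinite_rank_def
    proof clarify
      fix C assume C: "finite C" "range (p - q) \<subseteq> cspan C"
      have "p v \<in> cspan (B \<union> C)" for v
      proof -
        have "p v = q v + (p - q) v" by (simp add: blinfun.diff_left)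
        moreover have "q v \<in> cspan (B \<union> C)" "(p - q) v \<in> cspan (B \<union> C)"
          using B(2) C(2) complex_vector.span_mono[of B "B \<union> C"] complex_vector.span_mono[of C "B \<union> C"]
          by blast+
        ultimately show ?thesis by (metis complex_vector.span_add)
      qed
      with B(1) C(1) p(2) show False unfolding infinite_rank_def by (metis finite_UnI image_subsetI)
    qed
    moreover have "p o\<^sub>L p = p" using p by (simp add: masa_projection_def selfadjoint_idempotent_def)
    then have "p o\<^sub>L (p - q) = p - q" using q by (simp add: blinfun_compose.diff_right)
    ultimately show ?thesis
      using masa_projection_diff[OF D p(1) q(1,2)] q(3) by (intro exI[of _ "p - q"]) simp
  qed
qed

text \<open>
  The differences of consecutive terms in a strictly decreasing sequence of projections of infinite
  rank, which starts at \<open>1\<close>.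
\<close>

lemma masa_orthogonal_projections:
  fixes D :: "('a::complex_hilbert_space \<Rightarrow>\<^sub>L 'a) set"
  assumes inf: "\<not> (\<exists>B :: 'a set. finite B \<and> cspan B = UNIV)" and D: "masa D"
  obtains q :: "nat \<Rightarrow> 'a \<Rightarrow>\<^sub>L 'a"
  where "\<And>n. masa_projection D (q n)" "\<And>n. q n \<noteq> 0" "\<And>m n. m \<noteq> n \<Longrightarrow> q m o\<^sub>L q n = 0"
proof -
  have id: "masa_projection D id_blinfun"
    using masa_id[OF D] by (simp add: masa_projection_def selfadjoint_idempotent_def bounded_ops_def
        is_adjoint_def blinfun_compose_id)
  have infid: "infinite_rank (id_blinfun :: 'a \<Rightarrow>\<^sub>L 'a)"
    using inf by (auto simp: infinite_rank_def)
  have "\<exists>f. \<forall>n. (masa_projection D (f n) \<and> infinite_rank (f n)) \<and> (f n o\<^sub>L f (Suc n) = f (Suc n) \<and> f (Suc n) \<noteq> f n)"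
  proof (rule dependent_nat_choice)
    show "\<exists>p. masa_projection D p \<and> infinite_rank p" using id infid by blast
    show "\<exists>q. (masa_projection D q \<and> infinite_rank q) \<and> p o\<^sub>L q = q \<and> q \<noteq> p"
      if "masa_projection D p \<and> infinite_rank p" for p and n :: nat
      using infinite_rank_split[OF D] that by blast
  qed
  then obtain p where p: "\<And>n. masa_projection D (p n)" "\<And>n. p n o\<^sub>L p (Suc n) = p (Suc n)"
    "\<And>n. p (Suc n) \<noteq> p n"
    by blast
  have idem: "p n o\<^sub>L p n = p n" for n
    using p(1)[of n] by (simp add: masa_projection_def selfadjoint_idempotent_def)
  have le: "p n o\<^sub>L p m = p m" if "n \<le> m" for n m
    using that
  proof (induction rule: dec_induct)
    case (step m)
    have "p n o\<^sub>L p (Suc m) = (p n o\<^sub>L p m) o\<^sub>L p (Suc m)"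
      by (simp add: blinfun_compose_assoc p(2))
    then show ?case using step.IH p(2) by simp
  qed (rule idem)
  define q where "q n = p n - p (Suc n)" for n
  have qq: "q n o\<^sub>L q m = 0" if "n < m" for n m
    using that by (simp add: q_def blinfun_compose.diff_left blinfun_compose.diff_right le)
  have qD: "masa_projection D (q n)" for n
    unfolding q_def by (rule masa_projection_diff[OF D p(1) p(1) p(2)])
  show ?thesis
  proof (rule that[of q])
    show "q m o\<^sub>L q n = 0" if "m \<noteq> n" for m n
      using that qq[of m n] qq[of n m] masa_commute[OF D, of "q m" "q n"] qD
      by (metis linorder_neqE_nat masa_projection_def)
    show "q n \<noteq> 0" for n using p(3)[of n] by (simp add: q_def)
  qed (rule qD)
qed

section \<open>The norm of a column map\<close>

text \<open>
  The row \<open>e\<^sup>* x\<close> has norm at most \<open>\<parallel>x\<parallel>\<close>. Evaluating it on the combination of the \<open>u\<^sub>k\<close> that is dual to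
  its own coefficients turns this into a bound for their sum of squares.
\<close>

lemma functional_orthogonal_bound:
  fixes u :: "'k \<Rightarrow> 'a::complex_hilbert_space"
  assumes "finite K" and x: "x \<in> bounded_ops" and e: "norm e \<le> 1"
    and u: "\<And>k. k \<in> K \<Longrightarrow> norm (u k) \<le> 1"
    and orth: "\<And>k l. k \<in> K \<Longrightarrow> l \<in> K \<Longrightarrow> k \<noteq> l \<Longrightarrow> cinner (u k) (u l) = 0"
  shows "(\<Sum>k\<in>K. (cmod (cinner (x (u k)) e))\<^sup>2) \<le> (norm x)\<^sup>2"
proof -
  define a where "a k = cinner (x (u k)) e" for k
  define s where "s = (\<Sum>k\<in>K. (cmod (a k))\<^sup>2)"
  \<comment> \<open>The vector for which \<open>\<langle>x y, e\<rangle>\<close> equals \<open>s\<close>, while \<open>\<parallel>y\<parallel> \<le> \<surd>s\<close>.\<close>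
  define y where "y = (\<Sum>k\<in>K. cnj (a k) *\<^sub>C u k)"
  have "s \<ge> 0" by (simp add: s_def sum_nonneg)
  have "(norm y)\<^sup>2 = (\<Sum>k\<in>K. (norm (cnj (a k) *\<^sub>C u k))\<^sup>2)"
    unfolding y_def using assms
    by (intro norm_sum_orthogonal) (auto simp: cinner_scaleC_left cinner_scaleC_right)
  also have "\<dots> \<le> s"
    unfolding s_def norm_scaleC complex_mod_cnj
    using u by (intro sum_mono power_mono mult_left_le) auto
  finally have y: "norm y \<le> sqrt s" by (rule real_le_rsqrt)
  have "cinner (x y) e = complex_of_real s"
    by (simp add: y_def s_def blinfun.sum_right cinner.sum_left bounded_ops_scaleC[OF x]
        cinner_scaleC_left complex_norm_square a_def mult.commute del: of_real_power)
  then have "s \<le> norm (x y) * norm e"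
    using Cauchy_Schwarz_cinner[of "x y" e] \<open>s \<ge> 0\<close> by simp
  also have "\<dots> \<le> norm (x y) * 1" using e by (intro mult_left_mono) auto
  also have "\<dots> \<le> norm x * sqrt s"
    using norm_blinfun[of x y] mult_left_mono[OF y norm_ge_zero[of x]] by simp
  finally have "sqrt s * sqrt s \<le> norm x * sqrt s" using \<open>s \<ge> 0\<close> by simp
  then have "sqrt s \<le> norm x"
    using \<open>s \<ge> 0\<close> by (cases "s = 0") (simp, rule mult_right_le_imp_le[of _ "sqrt s"], auto)
  then have "s \<le> (norm x)\<^sup>2" using \<open>s \<ge> 0\<close> sqrt_le_D by blast
  then show ?thesis by (simp add: s_def a_def)
qed

text \<open>
  Compressed to the vectors \<open>e\<^sub>j\<close>, the operator \<open>x\<close> has \<open>card J\<close> rows of norm at most \<open>\<parallel>x\<parallel>\<close>, hence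
  Hilbert-Schmidt norm at most \<open>\<surd>(card J) \<parallel>x\<parallel>\<close>. The hypothesis on \<open>W\<^sub>k\<close> says that it only sees this
  compression, contractively. The Cauchy-Schwarz inequality over \<open>k\<close> then pairs the lengths
  \<open>\<parallel>q\<^sub>k h\<parallel>\<close> with the column norms, so the bound does not depend on the number of columns.
\<close>

lemma column_map_bound:
  fixes W q :: "'k \<Rightarrow> 'a::complex_hilbert_space \<Rightarrow>\<^sub>L 'a" and e :: "'j \<Rightarrow> 'a"
  assumes "finite K" "finite J" and x: "x \<in> bounded_ops"
    and W: "\<And>k y. k \<in> K \<Longrightarrow> norm (W k y) \<le> L2_set (\<lambda>j. cmod (cinner y (e j))) J"
    and e: "\<And>j. j \<in> J \<Longrightarrow> norm (e j) \<le> 1"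
    and q: "\<And>k. k \<in> K \<Longrightarrow> selfadjoint_idempotent (q k)"
    and orth: "\<And>k l. k \<in> K \<Longrightarrow> l \<in> K \<Longrightarrow> k \<noteq> l \<Longrightarrow> q k o\<^sub>L q l = 0"
  shows "norm (\<Sum>k\<in>K. W k o\<^sub>L x o\<^sub>L q k) \<le> sqrt (real (card J)) * norm x"
proof (rule norm_blinfun_bound)
  fix h :: 'a
  \<comment> \<open>If \<open>q\<^sub>k h = 0\<close>, the quotient by zero makes \<open>u\<^sub>k = 0\<close>, which is harmless below.\<close>
  define u where "u k = (1 / norm (q k h)) *\<^sub>R q k h" for k
  define c where "c k = L2_set (\<lambda>j. cmod (cinner (x (u k)) (e j))) J" for k
  have qorth: "cinner (q k h) (q l h) = 0" if "k \<in> K" "l \<in> K" "k \<noteq> l" for k l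
    using selfadjoint_idempotent_orthogonal[OF q[OF that(1)] orth[OF that]] .
  have qh: "q k h = norm (q k h) *\<^sub>R u k" for k
    by (simp add: u_def)
  have col: "(\<Sum>k\<in>K. (cmod (cinner (x (u k)) (e j)))\<^sup>2) \<le> (norm x)\<^sup>2" if "j \<in> J" for j
    using e[OF that] qorth
    by (intro functional_orthogonal_bound \<open>finite K\<close> x)
       (auto simp: u_def cinner.scaleR_left cinner.scaleR_right)
  have "norm ((\<Sum>k\<in>K. W k o\<^sub>L x o\<^sub>L q k) h) \<le> (\<Sum>k\<in>K. norm (W k (x (q k h))))"
    unfolding blinfun.sum_left by (simp add: norm_sum)
  also have "\<dots> = (\<Sum>k\<in>K. norm (q k h) * norm (W k (x (u k))))"
    by (subst (1) qh) (simp add: blinfun.scaleR_right)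
  also have "\<dots> \<le> (\<Sum>k\<in>K. \<bar>norm (q k h)\<bar> * \<bar>c k\<bar>)"
  proof (intro sum_mono)
    fix k assume "k \<in> K"
    have "c k \<ge> 0" by (simp add: c_def)
    then show "norm (q k h) * norm (W k (x (u k))) \<le> \<bar>norm (q k h)\<bar> * \<bar>c k\<bar>"
      using W[OF \<open>k \<in> K\<close>, of "x (u k)"] by (simp add: c_def mult_left_mono)
  qed
  also have "\<dots> \<le> L2_set (\<lambda>k. norm (q k h)) K * L2_set c K"
    by (rule L2_set_mult_ineq)
  also have "\<dots> \<le> norm h * (sqrt (real (card J)) * norm x)"
  proof (intro mult_mono)
    have "(\<Sum>k\<in>K. (norm (q k h))\<^sup>2) \<le> (norm h)\<^sup>2"
      using q by (intro Bessel_inequality \<open>finite K\<close> qorth selfadjoint_idempotent_cinner)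
    then show "L2_set (\<lambda>k. norm (q k h)) K \<le> norm h"
      unfolding L2_set_def by (intro real_le_lsqrt) auto
    have "(\<Sum>k\<in>K. (c k)\<^sup>2) = (\<Sum>j\<in>J. \<Sum>k\<in>K. (cmod (cinner (x (u k)) (e j)))\<^sup>2)"
      unfolding c_def L2_set_def by (subst sum.swap) (simp add: sum_nonneg)
    also have "\<dots> \<le> (\<Sum>j\<in>J. (norm x)\<^sup>2)"
      by (intro sum_mono col)
    finally show "L2_set c K \<le> sqrt (real (card J)) * norm x"
      unfolding L2_set_def by (intro real_le_lsqrt) (auto simp: power_mult_distrib)
  qed auto
  finally show "norm ((\<Sum>k\<in>K. W k o\<^sub>L x o\<^sub>L q k) h) \<le> sqrt (real (card J)) * norm x * norm h"
    by (simp add: mult.commute)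
qed auto

section \<open>Finite Fourier blocks\<close>

text \<open>
  The value at \<open>i\<close> of the \<open>b\<close>-th character of the cyclic group of order \<open>d\<close>.
\<close>

definition fourier_phase :: "nat \<Rightarrow> nat \<Rightarrow> nat \<Rightarrow> complex" where
  "fourier_phase d b i = cis (2 * pi * real b / real d) ^ i"

lemma cnj_fourier_phase_self: "cnj (fourier_phase d b i) * fourier_phase d b i = 1"
  by (simp add: fourier_phase_def cis_cnj cis_mult flip: power_mult_distrib)

lemma cmod_fourier_phase: "cmod (fourier_phase d b i) = 1"
  by (simp add: fourier_phase_def norm_power)

lemma fourier_phase_orthogonal:
  assumes "b < d" "b' < d"
  shows "(\<Sum>i<d. fourier_phase d b i * cnj (fourier_phase d b' i)) = (if b = b' then of_nat d else 0)"
proof (cases "b = b'")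
  case True
  then show ?thesis
    using cnj_fourier_phase_self by (simp add: mult.commute)
next
  case False
  let ?w = "\<lambda>k. cis (2 * pi * real k / real d)"
  define z where "z = ?w b * cnj (?w b')"
  have bij: "bij_betw ?w {..<d} {z. z ^ d = 1}"
    using assms by (intro Complex.bij_betw_roots_unity) auto
  have "z \<noteq> 1"
  proof
    assume "z = 1"
    then have "?w b * (cnj (?w b') * ?w b') = ?w b'" by (simp add: z_def flip: mult.assoc)
    then have "?w b = ?w b'" by (simp add: cis_cnj cis_mult)
    then show False
      using bij_betw_imp_inj_on[OF bij] assms False by (auto dest: inj_onD)
  qed
  moreover have "?w b ^ d = 1" "?w b' ^ d = 1"
    using bij_betw_apply[OF bij] assms by auto
  then have "z ^ d = 1"
    by (simp add: z_def power_mult_distrib flip: complex_cnj_power)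
  ultimately have "(\<Sum>i<d. z ^ i) = 0" by (simp add: geometric_sum)
  then show ?thesis
    using False by (simp add: fourier_phase_def z_def power_mult_distrib)
qed

lemma fourier_Parseval:
  "(\<Sum>i<d. (cmod (\<Sum>b<d. c b * fourier_phase d b i))\<^sup>2) = real d * (\<Sum>b<d. (cmod (c b))\<^sup>2)"
proof -
  let ?p = "fourier_phase d"
  have "complex_of_real (\<Sum>i<d. (cmod (\<Sum>b<d. c b * ?p b i))\<^sup>2)
      = (\<Sum>i<d. \<Sum>b<d. \<Sum>b'<d. c b * cnj (c b') * (?p b i * cnj (?p b' i)))"
    unfolding of_real_sum complex_norm_square cnj_sum sum_product
    by (intro sum.cong refl) simp
  also have "\<dots> = (\<Sum>b<d. \<Sum>i<d. \<Sum>b'<d. c b * cnj (c b') * (?p b i * cnj (?p b' i)))"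
    by (rule sum.swap)
  also have "\<dots> = (\<Sum>b<d. \<Sum>b'<d. \<Sum>i<d. c b * cnj (c b') * (?p b i * cnj (?p b' i)))"
    by (rule sum.cong[OF refl], rule sum.swap)
  also have "\<dots> = (\<Sum>b<d. \<Sum>b'<d. c b * cnj (c b') * (if b = b' then of_nat d else 0))"
    by (simp add: fourier_phase_orthogonal flip: sum_distrib_left)
  also have "\<dots> = (\<Sum>b<d. c b * cnj (c b) * of_nat d)"
    by (intro sum.cong refl) (simp add: if_distrib cong: if_cong)
  also have "\<dots> = complex_of_real (real d * (\<Sum>b<d. (cmod (c b))\<^sup>2))"
    by (simp add: complex_norm_square sum_distrib_left mult.commute del: of_real_power)
  finally show ?thesis by (simp only: of_real_eq_iff)
qed

text \<open>
  The adjoint of the partial isometry \<open>e\<^sub>i \<mapsto> \<omega>\<^bsup>b i\<^esup> e\<^bsub>i+a\<^esub>\<close> (\<open>i < d\<close>, \<open>\<omega> = exp (2 \<pi> \<i> / d)\<close>), which is a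
  Weyl unitary except that the shift is not reduced modulo \<open>d\<close>; this doubles the number of basis
  vectors involved and so costs only a constant factor in the norm bound.
\<close>

definition fourier_shift :: "nat \<Rightarrow> (nat \<Rightarrow> 'a::complex_hilbert_space) \<Rightarrow> nat \<times> nat \<Rightarrow> 'a \<Rightarrow>\<^sub>L 'a" where
  "fourier_shift d e = (\<lambda>(a, b). \<Sum>i<d. rank_one (cnj (fourier_phase d b i) *\<^sub>C e i) (e (i + a)))"

lemma fourier_shift_apply:
  "fourier_shift d e (a, b) y = (\<Sum>i<d. (cinner y (e (i + a)) * cnj (fourier_phase d b i)) *\<^sub>C e i)"
  by (simp add: fourier_shift_def blinfun.sum_left rank_one_apply scaleC_scaleC)

lemma fourier_shift_bounded: "fourier_shift d e k \<in> bounded_ops"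
  unfolding fourier_shift_def by (auto simp: case_prod_unfold intro!: bounded_ops_sum rank_one_bounded)

lemma fourier_shift_norm:
  assumes e: "\<And>i j. cinner (e i) (e j) = (if i = j then 1 else 0)" and "a < d"
  shows "norm (fourier_shift d e (a, b) y) \<le> L2_set (\<lambda>j. cmod (cinner y (e j))) {..<2 * d}"
  unfolding L2_set_def
proof (rule real_le_rsqrt)
  have "(norm (fourier_shift d e (a, b) y))\<^sup>2 = (\<Sum>i<d. (cmod (cinner y (e (i + a))))\<^sup>2)"
    unfolding fourier_shift_apply
    by (subst orthonormal_combination_norm) (auto simp: e norm_mult cmod_fourier_phase)
  also have "\<dots> = (\<Sum>j\<in>(\<lambda>i. i + a) ` {..<d}. (cmod (cinner y (e j)))\<^sup>2)"
    by (subst sum.reindex) (auto simp: inj_on_def)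
  also have "\<dots> \<le> (\<Sum>j<2 * d. (cmod (cinner y (e j)))\<^sup>2)"
    using \<open>a < d\<close> by (intro sum_mono2) auto
  finally show "(norm (fourier_shift d e (a, b) y))\<^sup>2 \<le> (\<Sum>j<2 * d. (cmod (cinner y (e j)))\<^sup>2)" .
qed

definition fourier_block :: "nat \<Rightarrow> (nat \<Rightarrow> 'a::complex_hilbert_space) \<Rightarrow> (nat \<times> nat \<Rightarrow> 'a \<Rightarrow>\<^sub>L 'a)
    \<Rightarrow> ('a \<Rightarrow>\<^sub>L 'a) \<Rightarrow> 'a \<Rightarrow>\<^sub>L 'a" where
  "fourier_block d e q x =
     (1 / sqrt (real d)) *\<^sub>R (\<Sum>k\<in>{..<d} \<times> {..<d}. fourier_shift d e k o\<^sub>L x o\<^sub>L q k)"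

lemma fourier_block_norm:
  assumes e: "\<And>i j. cinner (e i) (e j) = (if i = j then 1 else 0)" and x: "x \<in> bounded_ops"
    and q: "\<And>k. selfadjoint_idempotent (q k)" "\<And>k l. k \<noteq> l \<Longrightarrow> q k o\<^sub>L q l = 0"
  shows "norm (fourier_block d e q x) \<le> sqrt 2 * norm x"
proof (cases "d = 0")
  case False
  have "norm (e j) = 1" for j
    using e[of j j] by (simp add: norm_eq_sqrt_cinner)
  then have "norm (\<Sum>k\<in>{..<d} \<times> {..<d}. fourier_shift d e k o\<^sub>L x o\<^sub>L q k) \<le> sqrt (real (card {..<2 * d})) * norm x"
    using q fourier_shift_norm[OF e] by (intro column_map_bound[where e = e] x) auto
  then have "norm (fourier_block d e q x) \<le> 1 / sqrt (real d) * (sqrt (real (2 * d)) * norm x)"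
    unfolding fourier_block_def norm_scaleR by (simp add: mult_left_mono divide_right_mono)
  then show ?thesis using False by (simp add: real_sqrt_mult)
qed (simp add: fourier_block_def)

lemma fourier_block_0: "fourier_block d e q 0 = 0"
  unfolding fourier_block_def by (simp add: blinfun_compose.zero_left blinfun_compose.zero_right)

lemma fourier_block_add: "fourier_block d e q (x + y) = fourier_block d e q x + fourier_block d e q y"
  unfolding fourier_block_def
  by (simp add: blinfun_compose.add_left blinfun_compose.add_right sum.distrib scaleR_add_right)

lemma fourier_block_op_scaleC:
  "fourier_block d e q (op_scaleC c x) = op_scaleC c (fourier_block d e q x)"
  by (rule blinfun_eqI)
     (simp add: fourier_block_def blinfun.scaleR_left blinfun.sum_left op_scaleC_apply scaleR_scaleC
        bounded_ops_scaleC[OF fourier_shift_bounded] scaleC_scaleC mult.commute flip: complex_vector.scale_sum_right)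

lemma fourier_block_compose:
  assumes "\<And>k. q k o\<^sub>L y = y o\<^sub>L q k"
  shows "fourier_block d e q (x o\<^sub>L y) = fourier_block d e q x o\<^sub>L y"
proof -
  have "fourier_shift d e k o\<^sub>L (x o\<^sub>L y) o\<^sub>L q k = (fourier_shift d e k o\<^sub>L x o\<^sub>L q k) o\<^sub>L y" for k
    by (simp add: blinfun_compose_assoc assms)
  then show ?thesis
    unfolding fourier_block_def
    by (simp add: blinfun_compose.scaleR_left blinfun_compose.sum_left)
qed

lemma fourier_block_compact:
  assumes "x \<in> compact_ops" "\<And>k. q k \<in> bounded_ops"
  shows "fourier_block d e q x \<in> compact_ops"
  unfolding fourier_block_def using assms fourier_shift_bounded
  by (intro compact_ops_scaleR compact_ops_sum compact_ops_compose_right compact_ops_compose_left) auto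

text \<open>
  Component \<open>i\<close> of the operator \<open>H \<rightarrow> H\<^sup>d\<close> that maps the unit vector \<open>f (a, b)\<close> to
  \<open>d\<^bsup>-1/2\<^esup> (\<omega>\<^bsup>b i\<^esup> e\<^bsub>i+a\<^esub>)\<^sub>i\<close>, the image of a maximally entangled vector under such a partial isometry.
\<close>

definition fourier_column :: "nat \<Rightarrow> (nat \<Rightarrow> 'a::complex_hilbert_space) \<Rightarrow> (nat \<times> nat \<Rightarrow> 'a) \<Rightarrow> nat \<Rightarrow> 'a \<Rightarrow>\<^sub>L 'a" where
  "fourier_column d e f i =
     (\<Sum>(a, b)\<in>{..<d} \<times> {..<d}. rank_one ((complex_of_real (1 / sqrt (real d)) * fourier_phase d b i) *\<^sub>C e (i + a)) (f (a, b)))"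

lemma fourier_column_compact: "fourier_column d e f i \<in> compact_ops"
  unfolding fourier_column_def by (auto intro!: compact_ops_sum rank_one_compact)

text \<open>
  The columns are orthonormal in \<open>H\<^sup>d\<close>: different shifts \<open>a\<close> have orthogonal values in every component,
  and for equal shifts the sum over the components is the orthogonality of characters.
\<close>

lemma fourier_column_contractive:
  assumes e: "\<And>i j. cinner (e i) (e j) = (if i = j then 1 else 0)"
    and f: "\<And>k l. cinner (f k) (f l) = (if k = l then 1 else 0)"
  shows "L2_set (\<lambda>i. norm (fourier_column d e f i h)) {..<d} \<le> norm h"
proof (cases "d = 0")
  case False
  let ?c = "\<lambda>a b. cinner h (f (a, b))"
  have "(norm (fourier_column d e f i h))\<^sup>2 = 1 / real d * (\<Sum>a<d. (cmod (\<Sum>b<d. ?c a b * fourier_phase d b i))\<^sup>2)" for i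
  proof -
    have "fourier_column d e f i h = (\<Sum>a<d. (complex_of_real (1 / sqrt (real d)) * (\<Sum>b<d. ?c a b * fourier_phase d b i)) *\<^sub>C e (i + a))"
      unfolding fourier_column_def
      by (simp add: sum.cartesian_product[symmetric] blinfun.sum_left rank_one_apply scaleC_scaleC
          sum_distrib_left complex_vector.scale_sum_left mult_ac)
    then have "(norm (fourier_column d e f i h))\<^sup>2
        = (\<Sum>a<d. (cmod (complex_of_real (1 / sqrt (real d)) * (\<Sum>b<d. ?c a b * fourier_phase d b i)))\<^sup>2)"
      by (simp only:) (rule orthonormal_combination_norm, auto simp: e)
    moreover have "(cmod (complex_of_real (1 / sqrt (real d))))\<^sup>2 = 1 / real d"
      by (simp add: norm_divide power_divide)
    ultimately show ?thesis
      by (simp only: norm_mult power_mult_distrib sum_distrib_left[symmetric])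
  qed
  then have "(\<Sum>i<d. (norm (fourier_column d e f i h))\<^sup>2)
      = 1 / real d * (\<Sum>a<d. \<Sum>i<d. (cmod (\<Sum>b<d. ?c a b * fourier_phase d b i))\<^sup>2)"
    by (subst sum.swap) (simp add: sum_distrib_left)
  also have "\<dots> = (\<Sum>k\<in>{..<d} \<times> {..<d}. (cmod (cinner h (f k)))\<^sup>2)"
    unfolding fourier_Parseval using False
    by (simp add: sum.cartesian_product' flip: sum_distrib_left)
  also have "\<dots> \<le> (norm h)\<^sup>2"
    by (rule orthonormal_Bessel) (auto simp: f)
  finally show ?thesis
    unfolding L2_set_def by (intro real_le_lsqrt) auto
qed simp

text \<open>
  Each \<open>fourier_shift\<close> undoes the twist of its own column, so all \<open>d\<^sup>2\<close> columns become the same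
  vector of \<open>H\<^sup>d\<close>, whose component \<open>i\<close> is \<open>e\<^sub>i / d\<close>.
\<close>

lemma fourier_block_column:
  assumes e: "\<And>i j. cinner (e i) (e j) = (if i = j then 1 else 0)"
    and q: "\<And>k. selfadjoint_idempotent (q k)"
    and qf: "\<And>k l. q k (f l) = (if k = l then f l else 0)" and "i < d"
  shows "fourier_block d e q (fourier_column d e f i)
    = (1 / real d) *\<^sub>R (\<Sum>k\<in>{..<d} \<times> {..<d}. rank_one (e i) (f k))"
proof (rule blinfun_eqI)
  fix h :: 'a
  have qh: "cinner (q k h) (f l) = (if k = l then cinner h (f l) else 0)" for k l
  proof -
    have "cinner (q k h) (f l) = cinner h (q k (f l))"
      using q[of k] is_adjointD by (auto simp: selfadjoint_idempotent_def)
    then show ?thesis by (simp add: qf cinner.zero_right)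
  qed
  have shift: "fourier_shift d e (a, b) (fourier_phase d b i *\<^sub>C e (i + a)) = e i" for a b
  proof -
    have "fourier_shift d e (a, b) (fourier_phase d b i *\<^sub>C e (i + a))
        = (\<Sum>i'<d. if i' = i then (fourier_phase d b i * cnj (fourier_phase d b i)) *\<^sub>C e i else 0)"
      unfolding fourier_shift_apply by (intro sum.cong refl) (auto simp: cinner_scaleC_left e)
    then show ?thesis
      using \<open>i < d\<close> cnj_fourier_phase_self by (simp add: mult.commute scaleC_one)
  qed
  have col: "fourier_column d e f i (q (a, b) h)
      = (complex_of_real (1 / sqrt (real d)) * cinner h (f (a, b))) *\<^sub>C fourier_phase d b i *\<^sub>C e (i + a)"
    if "a < d" "b < d" for a b
  proof -
    have "fourier_column d e f i (q (a, b) h) = (\<Sum>k\<in>{..<d} \<times> {..<d}. if (a, b) = k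
        then (complex_of_real (1 / sqrt (real d)) * cinner h (f (a, b))) *\<^sub>C fourier_phase d b i *\<^sub>C e (i + a) else 0)"
      unfolding fourier_column_def blinfun.sum_left
      by (intro sum.cong refl) (auto simp: rank_one_apply qh scaleC_scaleC mult_ac split: if_split_asm)
    then show ?thesis using that by simp
  qed
  have "(fourier_shift d e k o\<^sub>L fourier_column d e f i o\<^sub>L q k) h
      = (1 / sqrt (real d)) *\<^sub>R rank_one (e i) (f k) h" if kd: "k \<in> {..<d} \<times> {..<d}" for k
  proof -
    obtain a b where k: "k = (a, b)" "a < d" "b < d" using kd by (cases k) auto
    show ?thesis
      unfolding k(1) blinfun_apply_blinfun_compose col[OF k(2,3)]
        bounded_ops_scaleC[OF fourier_shift_bounded] shift[unfolded bounded_ops_scaleC[OF fourier_shift_bounded]]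
      by (simp add: rank_one_apply scaleR_scaleC scaleC_scaleC)
  qed
  then show "fourier_block d e q (fourier_column d e f i) h
      = ((1 / real d) *\<^sub>R (\<Sum>k\<in>{..<d} \<times> {..<d}. rank_one (e i) (f k))) h"
    using \<open>i < d\<close> unfolding fourier_block_def blinfun.scaleR_left blinfun.sum_left
    by (simp add: scaleR_right.sum[symmetric])
qed

text \<open>
  A row of \<open>d\<^sup>2\<close> equal entries has norm \<open>d\<close> times that of one entry, attained at the normalised sum \<open>h\<close> of
  the \<open>f\<^sub>k\<close>; the common entry \<open>(e\<^sub>i / d)\<^sub>i\<close> has norm \<open>d\<^bsup>-1/2\<^esup>\<close>.
\<close>

lemma fourier_block_column_norm:
  fixes e :: "nat \<Rightarrow> 'a::complex_hilbert_space"
  assumes "d > 0" and e: "\<And>i j. cinner (e i) (e j) = (if i = j then 1 else 0)"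
    and f: "\<And>k l. cinner (f k) (f l) = (if k = l then 1 else 0)"
    and q: "\<And>k. selfadjoint_idempotent (q k)"
    and qf: "\<And>k l. q k (f l) = (if k = l then f l else 0)"
  obtains h where "norm h = 1"
    "L2_set (\<lambda>i. norm (fourier_block d e q (fourier_column d e f i) h)) {..<d} = sqrt (real d)"
proof -
  define h where "h = (1 / real d) *\<^sub>R (\<Sum>k\<in>{..<d} \<times> {..<d}. f k)"
  have norm_e: "norm (e i) = 1" for i
    using e[of i i] by (simp add: norm_eq_sqrt_cinner)
  have "(norm (\<Sum>k\<in>{..<d} \<times> {..<d}. f k))\<^sup>2 = (real d)\<^sup>2"
    using orthonormal_combination_norm[of "{..<d} \<times> {..<d}" f "\<lambda>_. 1"]
    by (simp add: f scaleC_one power2_eq_square)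
  then have "norm (\<Sum>k\<in>{..<d} \<times> {..<d}. f k) = real d"
    by (simp add: power2_eq_iff_nonneg)
  then have "norm h = 1" using \<open>d > 0\<close> by (simp add: h_def)
  moreover have hf: "cinner h (f l) = 1 / real d" if "l \<in> {..<d} \<times> {..<d}" for l
    using that by (simp add: h_def cinner.scaleR_left cinner.sum_left f scaleR_conv_of_real)
  have "norm (fourier_block d e q (fourier_column d e f i) h) = 1" if "i < d" for i
  proof -
    have "(\<Sum>k\<in>{..<d} \<times> {..<d}. rank_one (e i) (f k) h) = (\<Sum>k\<in>{..<d} \<times> {..<d}. (1 / real d) *\<^sub>R e i)"
      by (intro sum.cong refl) (simp add: rank_one_apply hf scaleR_scaleC)
    also have "\<dots> = real d *\<^sub>R e i"
      using \<open>d > 0\<close> by (simp add: sum_constant_scaleR)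
    finally show ?thesis
      unfolding fourier_block_column[OF e q qf that] blinfun.scaleR_left blinfun.sum_left
      using \<open>d > 0\<close> by (simp add: norm_e)
  qed
  then have "L2_set (\<lambda>i. norm (fourier_block d e q (fourier_column d e f i) h)) {..<d} = sqrt (real d)"
    by (simp add: L2_set_def)
  ultimately show ?thesis by (rule that)
qed

lemma fourier_block_column_disjoint:
  assumes "\<And>k. selfadjoint_idempotent (q k)" "\<And>k l. q k (f l) = 0"
  shows "fourier_block d e q (fourier_column d' e f i) = 0"
proof -
  have "cinner (q k h) (f l) = 0" for k l h
  proof -
    have "cinner (q k h) (f l) = cinner h (q k (f l))"
      using assms(1)[of k] is_adjointD by (auto simp: selfadjoint_idempotent_def)
    then show ?thesis by (simp add: assms(2) cinner.zero_right)
  qed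
  then have "fourier_column d' e f i o\<^sub>L q k = 0" for k
    by (intro blinfun_eqI) (simp add: fourier_column_def blinfun.sum_left rank_one_apply case_prod_unfold)
  then show ?thesis
    by (simp add: fourier_block_def blinfun_compose_assoc blinfun_compose.zero_right)
qed

section \<open>Operator columns as matrices\<close>

text \<open>
  Operator columns \<open>H \<rightarrow> H\<^sup>n\<close> enter the amplifications as square matrices padded with zeros.
\<close>

definition first_column :: "(nat \<Rightarrow> 'a::complex_hilbert_space \<Rightarrow>\<^sub>L 'a) \<Rightarrow> nat \<Rightarrow> nat \<Rightarrow> 'a \<Rightarrow>\<^sub>L 'a" where
  "first_column C i j = (if j = 0 then C i else 0)"

lemma first_column_sum:
  "n > 0 \<Longrightarrow> (\<Sum>j<n. blinfun_apply (first_column C i j) (\<xi> j)) = C i (\<xi> 0)"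
  by (subst sum.mono_neutral_right[of _ "{0}"]) (auto simp: first_column_def)

lemma mat_norm_first_column_le:
  fixes C :: "nat \<Rightarrow> 'a::complex_hilbert_space \<Rightarrow>\<^sub>L 'a"
  assumes "n > 0" "\<And>h. L2_set (\<lambda>i. norm (C i h)) {..<n} \<le> norm h"
  shows "mat_norm n (first_column C) \<le> 1"
  unfolding mat_norm_def
proof (rule cSUP_least)
  have "L2_set (\<lambda>j. norm (0 :: 'a)) {..<n} \<le> 1" by (simp add: L2_set_def)
  then show "{\<xi> :: nat \<Rightarrow> 'a. L2_set (\<lambda>j. norm (\<xi> j)) {..<n} \<le> 1} \<noteq> {}"
    by (intro CollectI[THEN ex_in_conv[THEN iffD1, OF exI]])
  fix \<xi> :: "nat \<Rightarrow> 'a" assume "\<xi> \<in> {\<xi>. L2_set (\<lambda>j. norm (\<xi> j)) {..<n} \<le> 1}"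
  then have "norm (\<xi> 0) \<le> 1"
    using member_le_L2_set[of "{..<n}" 0 "\<lambda>j. norm (\<xi> j)"] \<open>n > 0\<close> by force
  with assms(2)[of "\<xi> 0"]
  show "L2_set (\<lambda>i. norm (\<Sum>j<n. blinfun_apply (first_column C i j) (\<xi> j))) {..<n} \<le> 1"
    by (simp add: first_column_sum[OF \<open>n > 0\<close>])
qed

lemma mat_norm_first_column_ge:
  fixes C :: "nat \<Rightarrow> 'a::complex_hilbert_space \<Rightarrow>\<^sub>L 'a"
  assumes "n > 0" "norm h \<le> 1"
  shows "L2_set (\<lambda>i. norm (C i h)) {..<n} \<le> mat_norm n (first_column C)"
proof -
  define \<xi> where "\<xi> j = (if j = 0 then h else 0)" for j :: nat
  have "L2_set (\<lambda>j. norm (\<xi> j)) {..<n} = L2_set (\<lambda>j. norm (\<xi> j)) {0}"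
    unfolding L2_set_def using \<open>n > 0\<close>
    by (intro arg_cong[of _ _ sqrt] sum.mono_neutral_right) (auto simp: \<xi>_def)
  then have "\<xi> \<in> {\<xi>. L2_set (\<lambda>j. norm (\<xi> j)) {..<n} \<le> 1}"
    using assms by (simp add: \<xi>_def)
  from cSUP_upper[OF this mat_norm_bdd_above[of "first_column C" n]]
  show ?thesis
    unfolding mat_norm_def first_column_sum[OF \<open>n > 0\<close>] by (simp add: \<xi>_def)
qed

section \<open>A bounded module map which is not completely bounded\<close>

theorem corollary6p12:
  fixes D :: "('a::complex_hilbert_space \<Rightarrow>\<^sub>L 'a) set"
  assumes "\<not> (\<exists>B :: 'a set. finite B \<and> cspan B = UNIV)"
    and "masa D"
  shows "\<exists>T. right_module_map D T \<and> bounded_map T \<and> \<not> completely_bounded T"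
proof -
  obtain p :: "nat \<Rightarrow> 'a \<Rightarrow>\<^sub>L 'a" where p: "\<And>n. masa_projection D (p n)" "\<And>n. p n \<noteq> 0"
    "\<And>m n. m \<noteq> n \<Longrightarrow> p m o\<^sub>L p n = 0"
    by (rule masa_orthogonal_projections[OF assms]) blast
  have pD: "p n \<in> D" and pidem: "selfadjoint_idempotent (p n)" and pB: "p n \<in> bounded_ops" for n
    using p(1)[of n] by (auto simp: masa_projection_def selfadjoint_idempotent_def)
  have "\<exists>v. p n v \<noteq> 0" for n
    using p(2)[of n] by (metis blinfun_eqI zero_blinfun.rep_eq)
  then obtain w where w: "\<And>n. p n (w n) \<noteq> 0" by metis
  define e where "e n = (1 / norm (p n (w n))) *\<^sub>R p n (w n)" for n
  have norm_e: "norm (e n) = 1" for n using w[of n] by (simp add: e_def)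
  have pe: "p m (e n) = (if m = n then e n else 0)" for m n
  proof (cases "m = n")
    case False
    then have "p m (p n (w n)) = 0"
      using p(3)[of m n] by (metis blinfun_apply_blinfun_compose zero_blinfun.rep_eq)
    then show ?thesis using False by (simp add: e_def blinfun.scaleR_right)
  qed (simp add: e_def blinfun.scaleR_right selfadjoint_idempotent_apply[OF pidem])
  have e: "cinner (e m) (e n) = (if m = n then 1 else 0)" for m n
  proof (cases "m = n")
    case False
    have "cinner (p m (e m)) (p n (e n)) = 0"
      by (rule selfadjoint_idempotent_orthogonal[OF pidem p(3)[OF False]])
    then show ?thesis using False by (simp add: pe)
  qed (simp add: cinner_self norm_e)
  \<comment> \<open>Block \<open>m\<close> owns the projections \<open>p (code m k)\<close>, so that different blocks act on orthogonal
    sets of columns.\<close>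
  define code where "code m k = prod_encode (m, prod_encode k)" for m :: nat and k
  have code: "code m k = code m' k' \<longleftrightarrow> m = m' \<and> k = k'" for m m' k k'
    by (auto simp: code_def prod_encode_eq)
  \<comment> \<open>The weights \<open>2\<^bsup>-m\<^esup>\<close> make the series converge; the size \<open>16\<^sup>m\<close> makes the lower bound
    \<open>2\<^bsup>-m\<^esup> \<surd>16\<^sup>m\<close> of the \<open>m\<close>-th term tend to infinity.\<close>
  define d where "d m = (16 :: nat) ^ m" for m
  define F where "F m = fourier_block (d m) e (\<lambda>k. p (code m k))" for m
  define T where "T x = (\<Sum>m. (1 / 2) ^ m *\<^sub>R F m x)" for x
  have F_norm: "norm (F m x) \<le> sqrt 2 * norm x" if "x \<in> bounded_ops" for m x
    unfolding F_def using that pidem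
    by (intro fourier_block_norm e) (auto simp: code intro!: p(3))
  have step: "norm ((1 / 2) ^ m *\<^sub>R F m x) \<le> (1 / 2) ^ m * (sqrt 2 * norm x)" if "x \<in> bounded_ops" for m x
    using F_norm[OF that, of m] by (simp add: mult_left_mono divide_right_mono power_divide)
  have geom: "(\<lambda>m. (1 / 2) ^ m * (sqrt 2 * norm x)) sums (2 * (sqrt 2 * norm x))" for x :: "'a \<Rightarrow>\<^sub>L 'a"
    using sums_mult2[OF geometric_sums[of "1 / 2 :: real"], of "sqrt 2 * norm x"] by simp
  have summ: "summable (\<lambda>m. (1 / 2) ^ m *\<^sub>R F m x)" if "x \<in> bounded_ops" for x
    by (rule summable_comparison_test'[OF sums_summable[OF geom[of x]], of 0]) (rule step[OF that])
  have T_norm: "norm (T x) \<le> 2 * (sqrt 2 * norm x)" if "x \<in> bounded_ops" for x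
    unfolding T_def sums_unique[OF geom]
    by (rule norm_suminf_le[OF step[OF that] sums_summable[OF geom]])
  have Kb: "x \<in> bounded_ops" if "x \<in> compact_ops" for x
    using that by (simp add: compact_ops_def)
  have "T x \<in> compact_ops" if x: "x \<in> compact_ops" for x
  proof (rule compact_ops_limit)
    show "(\<lambda>n. \<Sum>m<n. (1 / 2) ^ m *\<^sub>R F m x) \<longlonglongrightarrow> T x"
      unfolding T_def using summ[OF Kb[OF x]] by (rule summable_LIMSEQ)
    show "(\<Sum>m<n. (1 / 2) ^ m *\<^sub>R F m x) \<in> compact_ops" for n
      unfolding F_def by (intro compact_ops_sum compact_ops_scaleR fourier_block_compact x pB)
  qed
  moreover have "T (x + y) = T x + T y" if "x \<in> compact_ops" "y \<in> compact_ops" for x y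
    unfolding T_def using suminf_add[OF summ[OF Kb[OF that(1)]] summ[OF Kb[OF that(2)]]]
    by (simp add: F_def fourier_block_add scaleR_add_right)
  moreover have "T (op_scaleC c x) = op_scaleC c (T x)" if "x \<in> compact_ops" for c x
  proof -
    have op: "op_scaleC c = (\<lambda>A. op_scaleC c id_blinfun o\<^sub>L A)"
      by (rule ext, rule blinfun_eqI) (simp add: op_scaleC_apply)
    have "bounded_linear (op_scaleC c :: ('a \<Rightarrow>\<^sub>L 'a) \<Rightarrow> _)"
      by (subst op) (rule blinfun_compose.bounded_linear_right)
    from bounded_linear.suminf[OF this summ[OF Kb[OF that]]]
    show ?thesis
      unfolding T_def F_def fourier_block_op_scaleC
      by (simp add: linear_scale[OF bounded_linear.linear[OF \<open>bounded_linear (op_scaleC c)\<close>]])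
  qed
  moreover have "T (x o\<^sub>L y) = T x o\<^sub>L y" if "x \<in> compact_ops" "y \<in> D" for x y
  proof -
    have "F m (x o\<^sub>L y) = F m x o\<^sub>L y" for m
      unfolding F_def by (intro fourier_block_compose masa_commute[OF assms(2)] pD that)
    then show ?thesis
      unfolding T_def
      using bounded_linear.suminf[OF blinfun_compose.bounded_linear_left[of y] summ[OF Kb[OF that(1)]]]
      by (simp add: blinfun_compose.scaleR_left)
  qed
  ultimately have "right_module_map D T"
    unfolding right_module_map_def by blast
  moreover have "bounded_map T"
  proof -
    have "map_norm T \<le> ennreal (2 * sqrt 2)"
      unfolding map_norm_def
    proof (rule SUP_least)
      fix x :: "'a \<Rightarrow>\<^sub>L 'a" assume "x \<in> {x \<in> compact_ops. norm x \<le> 1}"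
      then show "ennreal (norm (T x)) \<le> ennreal (2 * sqrt 2)"
        by (intro ennreal_leI order_trans[OF T_norm[OF Kb]]) auto
    qed
    then show ?thesis
      unfolding bounded_map_def using order_le_less_trans by fastforce
  qed
  moreover have "\<not> completely_bounded T"
  proof -
    have lower: "ennreal (2 ^ m) \<le> cb_norm T" for m
    proof -
      \<comment> \<open>Test \<open>T\<close> on the operator column supported by block \<open>m\<close>; all other blocks vanish there.\<close>
      define f where "f k = e (code m k)" for k
      define C where "C = fourier_column (d m) e f"
      have d: "d m > 0" by (simp add: d_def)
      have f: "cinner (f k) (f l) = (if k = l then 1 else 0)" for k l
        by (simp add: f_def e code)
      have C: "C i \<in> compact_ops" for i
        unfolding C_def by (rule fourier_column_compact)
      have other: "F m' (C i) = 0" if "m' \<noteq> m" for m' i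
        unfolding F_def C_def using that
        by (intro fourier_block_column_disjoint pidem) (simp add: f_def pe code)
      have TC: "T (C i) = (1 / 2) ^ m *\<^sub>R F m (C i)" for i
        unfolding T_def using other suminf_finite[of "{m}" "\<lambda>m. (1 / 2) ^ m *\<^sub>R F m (C i)"] by simp
      have pf: "p (code m k) (f l) = (if k = l then f l else 0)" for k l
        by (simp add: f_def pe code)
      obtain h where h: "norm h = 1" "L2_set (\<lambda>i. norm (F m (C i) h)) {..<d m} = sqrt (real (d m))"
        unfolding F_def C_def
        by (rule fourier_block_column_norm[OF d e f pidem pf])
      have "L2_set (\<lambda>i. norm (T (C i) h)) {..<d m} = (1 / 2) ^ m * sqrt (real (d m))"
        unfolding h(2)[symmetric] TC by (simp add: blinfun.scaleR_left L2_set_right_distrib)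
      also have "sqrt (real (d m)) = 4 ^ m"
        by (rule real_sqrt_unique) (simp_all add: d_def power2_eq_square flip: power_mult_distrib)
      also have "(1 / 2) ^ m * 4 ^ m = (2 :: real) ^ m"
        by (simp flip: power_mult_distrib)
      finally have "L2_set (\<lambda>i. norm (T (C i) h)) {..<d m} = 2 ^ m" .
      then have "2 ^ m \<le> mat_norm (d m) (first_column (\<lambda>i. T (C i)))"
        using mat_norm_first_column_ge[OF d, of h "\<lambda>i. T (C i)"] h(1) by simp
      also have "first_column (\<lambda>i. T (C i)) = (\<lambda>i j. T (first_column C i j))"
        by (intro ext) (simp add: first_column_def T_def F_def fourier_block_0)
      finally have "ennreal (2 ^ m) \<le> ennreal (mat_norm (d m) (\<lambda>i j. T (first_column C i j)))"
        by (rule ennreal_leI)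
      also have "\<dots> \<le> amplification_norm (d m) T"
        unfolding amplification_norm_def
      proof (rule SUP_upper, safe)
        show "first_column C i j \<in> compact_ops" for i j
          by (simp add: first_column_def C compact_ops_0)
        show "mat_norm (d m) (first_column C) \<le> 1"
          by (rule mat_norm_first_column_le[OF d]) (unfold C_def, rule fourier_column_contractive[OF e f])
      qed
      also have "\<dots> \<le> cb_norm T"
        unfolding cb_norm_def by (rule SUP_upper) (use d in simp)
      finally show ?thesis .
    qed
    have "cb_norm T = \<infinity>"
    proof (rule ccontr)
      assume "cb_norm T \<noteq> \<infinity>"
      then obtain r where r: "cb_norm T = ennreal r" "0 \<le> r" by (cases "cb_norm T") auto
      obtain m where "r < 2 ^ m" using real_arch_pow[of 2 r] by auto
      with lower[of m] r show False by simp
    qed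
    then show ?thesis by (simp add: completely_bounded_def)
  qed
  ultimately show ?thesis by blast
qed

end
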